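(* Let $\mathbb{K}$ be an algebraically closed field of characteristic $0$ and let $A_n(\mathbb{K})$ be the $n$-th Weyl algebra, $n\ge1$. For every integer $j$ with $n\le j\le 2n-1$ there exists an irreducible $A_n(\mathbb{K})$-module $M$ with $\mathrm{GKdim}\,M=j$.
   Context: For a finitely generated left module $M$ over a finitely generated algebra $A$, with finite-dimensional generating subspace $F\subset M$ and finite-dimensional generating subspace $V\ni 1$ of $A$, the Gelfand-Kirillov dimension is $\mathrm{GKdim}\,M=\limsup_{m\to\infty}\log_m\dim(V^mF)$ (independent of choices). *)

theory Defs
  imports
    "HOL-Library.Poly_Mapping"
    "HOL-Library.Extended_Real"
    "HOL-Library.Liminf_Limsup"
    "HOL-Library.Cardinality"
    "HOL-Computational_Algebra.Computational_Algebra"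
begin

section \<open>Modules over a unital algebra and Gelfand--Kirillov dimension\<close>

text \<open>
  The library locale for modules requires a commutative ring of scalars, so left modules over a
  possibly noncommutative ring are introduced here. The module is the whole type of vectors.
\<close>

locale left_module =
  fixes act :: "'a::ring_1 \<Rightarrow> 'm::ab_group_add \<Rightarrow> 'm"
  assumes act_add_right: "act a (u + v) = act a u + act a v"
    and act_add_left: "act (a + b) v = act a v + act b v"
    and act_mult: "act (a * b) v = act a (act b v)"
    and act_one: "act 1 v = v"
begin

definition submodule :: "'m set \<Rightarrow> bool" where
  "submodule N \<longleftrightarrow>
     0 \<in> N \<and> (\<forall>u\<in>N. \<forall>v\<in>N. u + v \<in> N) \<and> (\<forall>a. \<forall>v\<in>N. act a v \<in> N)"

definition irreducible_module :: bool where
  "irreducible_module \<longleftrightarrow>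
     (UNIV :: 'm set) \<noteq> {0} \<and> (\<forall>N. submodule N \<longrightarrow> N = {0} \<or> N = UNIV)"

end

text \<open>
  A unital associative algebra over a field, given by its (central) structure homomorphism.
\<close>

locale unital_algebra =
  fixes emb :: "'k::field \<Rightarrow> 'a::ring_1"
  assumes emb_add: "emb (c + d) = emb c + emb d"
    and emb_mult: "emb (c * d) = emb c * emb d"
    and emb_one: "emb 1 = 1"
    and emb_central: "emb c * a = a * emb c"
begin

sublocale alg: vector_space "\<lambda>c a. emb c * a"
  by unfold_locales (simp_all add: emb_add emb_mult emb_one algebra_simps)

definition subalgebra :: "'a set \<Rightarrow> bool" where
  "subalgebra S \<longleftrightarrow> alg.subspace S \<and> 1 \<in> S \<and> (\<forall>a\<in>S. \<forall>b\<in>S. a * b \<in> S)"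

definition alg_gen_subspace :: "'a set \<Rightarrow> bool" where
  "alg_gen_subspace V \<longleftrightarrow>
     alg.subspace V \<and> (\<exists>B. finite B \<and> alg.span B = V) \<and> 1 \<in> V \<and>
     (\<forall>S. subalgebra S \<and> V \<subseteq> S \<longrightarrow> S = UNIV)"

primrec subspace_power :: "'a set \<Rightarrow> nat \<Rightarrow> 'a set" where
  "subspace_power V 0 = alg.span {1}"
| "subspace_power V (Suc m) = alg.span {a * b |a b. a \<in> V \<and> b \<in> subspace_power V m}"

end

locale algebra_left_module = unital_algebra emb + left_module act
  for emb :: "'k::field \<Rightarrow> 'a::ring_1"
    and act :: "'a \<Rightarrow> 'm::ab_group_add \<Rightarrow> 'm"
begin

sublocale mdl: vector_space "\<lambda>c v. act (emb c) v"
  by unfold_locales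
    (simp_all add: emb_add emb_mult emb_one act_add_right act_add_left act_mult act_one)

definition mod_gen_subspace :: "'m set \<Rightarrow> bool" where
  "mod_gen_subspace F \<longleftrightarrow>
     mdl.subspace F \<and> (\<exists>B. finite B \<and> mdl.span B = F) \<and>
     (\<forall>N. submodule N \<and> F \<subseteq> N \<longrightarrow> N = UNIV)"

definition subspace_act :: "'a set \<Rightarrow> 'm set \<Rightarrow> 'm set" where
  "subspace_act W F = mdl.span {act a v |a v. a \<in> W \<and> v \<in> F}"

definition growth_exponent :: "'a set \<Rightarrow> 'm set \<Rightarrow> ereal" where
  "growth_exponent V F =
     limsup (\<lambda>m. ereal (log (real m) (real (mdl.dim (subspace_act (subspace_power V m) F)))))"

text \<open>
  The exponent does not depend on \<^term>\<open>V\<close> and \<^term>\<open>F\<close>. The dimension is meaningful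
  only when both kinds of generating subspace exist, i.e. when the algebra and the module are
  finitely generated.
\<close>

definition gk_dim :: ereal where
  "gk_dim =
     (SOME d. \<exists>V F. alg_gen_subspace V \<and> mod_gen_subspace F \<and> d = growth_exponent V F)"

end

section \<open>The Weyl algebra\<close>

datatype 'g word = Word "'g list"

instantiation word :: (type) monoid_add
begin

definition zero_word :: "'a word" where
  "zero_word = Word []"

fun plus_word :: "'a word \<Rightarrow> 'a word \<Rightarrow> 'a word" where
  "plus_word (Word u) (Word v) = Word (u @ v)"

instance
proof
  fix a b c :: "'a word"
  show "a + b + c = a + (b + c)" by (cases a; cases b; cases c) simp
  show "0 + a = a" by (cases a) (simp add: zero_word_def)
  show "a + 0 = a" by (cases a) (simp add: zero_word_def)
qed

end

text \<open>
  Concatenation of words is written additively, so that \<^typ>\<open>'g word \<Rightarrow>\<^sub>0 'k\<close> carries the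
  convolution product and is the free algebra over \<^typ>\<open>'g\<close>.
\<close>

datatype 'n weyl_gen = GX 'n | GD 'n

type_synonym ('n, 'k) free_weyl = "'n weyl_gen word \<Rightarrow>\<^sub>0 'k"

definition free_gen :: "'n weyl_gen \<Rightarrow> ('n, 'k::field) free_weyl" where
  "free_gen g = Poly_Mapping.single (Word [g]) 1"

abbreviation free_comm :: "'n weyl_gen \<Rightarrow> 'n weyl_gen \<Rightarrow> ('n, 'k::field) free_weyl" where
  "free_comm g h \<equiv> free_gen g * free_gen h - free_gen h * free_gen g"

definition weyl_relators :: "('n, 'k::field) free_weyl set" where
  "weyl_relators =
     {free_comm (GX i) (GX j) |i j. True} \<union>
     {free_comm (GD i) (GD j) |i j. True} \<union>
     {free_comm (GD i) (GX j) - (if i = j then 1 else 0) |i j. True}"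

text \<open>The two-sided ideal generated by the relators.\<close>

inductive_set weyl_ideal :: "('n, 'k::field) free_weyl set" where
  zero: "0 \<in> weyl_ideal"
| gen: "r \<in> weyl_relators \<Longrightarrow> a * r * b \<in> weyl_ideal"
| add: "p \<in> weyl_ideal \<Longrightarrow> q \<in> weyl_ideal \<Longrightarrow> p + q \<in> weyl_ideal"

lemma weyl_ideal_mult_left: "p \<in> weyl_ideal \<Longrightarrow> c * p \<in> weyl_ideal"
proof (induction rule: weyl_ideal.induct)
  case (gen r a b)
  then show ?case using weyl_ideal.gen[of r "c * a" b] by (simp add: mult.assoc)
qed (auto intro: weyl_ideal.intros simp: distrib_left)

lemma weyl_ideal_mult_right: "p \<in> weyl_ideal \<Longrightarrow> p * c \<in> weyl_ideal"
proof (induction rule: weyl_ideal.induct)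
  case (gen r a b)
  then show ?case using weyl_ideal.gen[of r a "b * c"] by (simp add: mult.assoc)
qed (auto intro: weyl_ideal.intros simp: distrib_right)

lemma weyl_ideal_uminus: "p \<in> weyl_ideal \<Longrightarrow> - p \<in> weyl_ideal"
  using weyl_ideal_mult_left[of p "- 1"] by simp

text \<open>
  The ideal is proper because the free algebra acts on power series, indexed by exponent
  functions, by multiplication and differentiation, and the relators act as zero.
\<close>

fun gen_op :: "'n weyl_gen \<Rightarrow> (('n \<Rightarrow> nat) \<Rightarrow> 'k::field) \<Rightarrow> ('n \<Rightarrow> nat) \<Rightarrow> 'k" where
  "gen_op (GX i) f m = (if m i = 0 then 0 else f (m(i := m i - 1)))"
| "gen_op (GD i) f m = of_nat (Suc (m i)) * f (m(i := Suc (m i)))"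

fun word_op :: "'n weyl_gen word \<Rightarrow> (('n \<Rightarrow> nat) \<Rightarrow> 'k::field) \<Rightarrow> ('n \<Rightarrow> nat) \<Rightarrow> 'k" where
  "word_op (Word gs) f = foldr gen_op gs f"

definition free_op ::
    "('n, 'k::field) free_weyl \<Rightarrow> (('n \<Rightarrow> nat) \<Rightarrow> 'k) \<Rightarrow> ('n \<Rightarrow> nat) \<Rightarrow> 'k" where
  "free_op p f m = (\<Sum>w\<in>Poly_Mapping.keys p. Poly_Mapping.lookup p w * word_op w f m)"

lemma gen_op_linear: "gen_op g (\<lambda>m. a * f m + b * h m) = (\<lambda>m. a * gen_op g f m + b * gen_op g h m)"
  by (cases g) (auto simp: fun_eq_iff algebra_simps)

lemma word_op_linear:
  "word_op w (\<lambda>m. a * f m + b * h m) = (\<lambda>m. a * word_op w f m + b * word_op w h m)"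
proof (cases w)
  case (Word gs)
  have "foldr gen_op gs (\<lambda>m. a * f m + b * h m) =
      (\<lambda>m. a * foldr gen_op gs f m + b * foldr gen_op gs h m)"
    by (induction gs) (simp_all add: gen_op_linear)
  with Word show ?thesis by simp
qed

lemma word_op_plus: "word_op (u + v) f = word_op u (word_op v f)"
  by (cases u; cases v) simp

lemma free_op_superset:
  assumes "finite A" "Poly_Mapping.keys p \<subseteq> A"
  shows "free_op p f m = (\<Sum>w\<in>A. Poly_Mapping.lookup p w * word_op w f m)"
  unfolding free_op_def
  by (rule sum.mono_neutral_left) (use assms in \<open>auto simp: in_keys_iff\<close>)

lemma free_op_add: "free_op (p + q) f = (\<lambda>m. free_op p f m + free_op q f m)"
proof
  fix m
  let ?A = "Poly_Mapping.keys p \<union> Poly_Mapping.keys q"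
  show "free_op (p + q) f m = free_op p f m + free_op q f m"
    using Poly_Mapping.keys_add[of p q]
    by (simp add: free_op_superset[of ?A] lookup_add distrib_right sum.distrib)
qed

lemma free_op_single: "free_op (Poly_Mapping.single w c) f = (\<lambda>m. c * word_op w f m)"
  by (auto simp: free_op_def fun_eq_iff)

lemma free_op_zero: "free_op 0 f = (\<lambda>m. 0)"
  by (auto simp: free_op_def fun_eq_iff)

lemma free_op_uminus: "free_op (- p) f = (\<lambda>m. - free_op p f m)"
  using free_op_add[of p "- p" f]
  by (simp add: free_op_zero fun_eq_iff) (metis add.inverse_unique)

lemma free_op_diff: "free_op (p - q) f = (\<lambda>m. free_op p f m - free_op q f m)"
  using free_op_add[of p "- q" f] by (simp add: free_op_uminus)

lemma free_op_one: "free_op 1 f = f"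
  by (simp add: free_op_single zero_word_def flip: single_one)

lemma update_eq_add_single:
  "a \<notin> Poly_Mapping.keys f \<Longrightarrow> Poly_Mapping.update a b f = f + Poly_Mapping.single a b"
  by (intro poly_mapping_eqI)
    (auto simp: lookup_update lookup_add lookup_single when_def in_keys_iff)

lemma free_op_single_mult:
  "free_op (Poly_Mapping.single u c * q) f = (\<lambda>m. c * word_op u (free_op q f) m)"
proof (induction q rule: update_induct)
  case const
  show ?case
    using word_op_linear[of u 0 "\<lambda>m. 0" 0 "\<lambda>m. 0"] by (auto simp: free_op_zero fun_eq_iff)
next
  case (update q v b)
  have "word_op u (\<lambda>m. free_op q f m + b * word_op v f m) =
      (\<lambda>m. word_op u (free_op q f) m + b * word_op u (word_op v f) m)"
    using word_op_linear[of u 1 "free_op q f" b "word_op v f"] by simp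
  with update show ?case
    by (simp add: update_eq_add_single distrib_left free_op_add free_op_single mult_single
        word_op_plus mult.assoc)
qed

lemma free_op_mult: "free_op (p * q) f = free_op p (free_op q f)"
proof (induction p rule: update_induct)
  case const
  show ?case by (simp add: free_op_zero)
next
  case (update p u c)
  then show ?case
    by (simp add: update_eq_add_single distrib_right free_op_add free_op_single_mult
        free_op_single)
qed

lemma free_op_gen: "free_op (free_gen g) f = gen_op g f"
  by (simp add: free_gen_def free_op_single)

lemma free_op_relator:
  assumes "r \<in> weyl_relators"
  shows "free_op r f = (\<lambda>m. 0)"
proof -
  consider (xx) i j where "r = free_comm (GX i) (GX j)"
    | (dd) i j where "r = free_comm (GD i) (GD j)"
    | (dx) i j where "r = free_comm (GD i) (GX j) - (if i = j then 1 else 0)"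
    using assms unfolding weyl_relators_def by blast
  then show ?thesis
  proof cases
    case xx
    then show ?thesis
      by (auto simp: free_op_diff free_op_mult free_op_gen fun_eq_iff fun_upd_twist)
  next
    case dd
    then show ?thesis
      by (auto simp: free_op_diff free_op_mult free_op_gen fun_eq_iff fun_upd_twist)
  next
    case dx
    have "gen_op (GD i) (gen_op (GX j) f) m - gen_op (GX j) (gen_op (GD i) f) m =
        (if i = j then f m else 0)" for m
    proof (cases "i = j")
      case True
      have "m(j := k) = m" if "m j = k" for k using that by auto
      with True show ?thesis by (cases "m j") (simp_all add: algebra_simps)
    qed (auto simp: fun_upd_twist)
    with dx show ?thesis
      by (auto simp: free_op_diff free_op_mult free_op_gen free_op_one free_op_zero fun_eq_iff)
  qed
qed

lemma free_op_const_zero: "free_op (p :: ('a, 'b::field) free_weyl) (\<lambda>m. 0) = (\<lambda>m. 0)"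
proof -
  have "word_op w (\<lambda>m. 0 :: 'b) = (\<lambda>m. 0)" for w :: "'a weyl_gen word"
    using word_op_linear[of w 0 "\<lambda>m. 0" 0 "\<lambda>m. 0"] by simp
  then show ?thesis by (simp add: free_op_def fun_eq_iff)
qed

lemma free_op_ideal: "p \<in> weyl_ideal \<Longrightarrow> free_op p f = (\<lambda>m. 0)"
  by (induction rule: weyl_ideal.induct)
    (simp_all add: free_op_zero free_op_add free_op_mult free_op_relator free_op_const_zero)

lemma one_notin_weyl_ideal: "1 \<notin> weyl_ideal"
proof
  assume "(1 :: ('a, 'b) free_weyl) \<in> weyl_ideal"
  then have "(\<lambda>m. 1 :: 'b) = (\<lambda>m :: 'a \<Rightarrow> nat. 0)"
    by (metis free_op_ideal free_op_one)
  then show False by (simp add: fun_eq_iff)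
qed

definition weyl_rel :: "('n, 'k::field) free_weyl \<Rightarrow> ('n, 'k) free_weyl \<Rightarrow> bool" where
  "weyl_rel p q \<longleftrightarrow> p - q \<in> weyl_ideal"

lemma equivp_weyl_rel: "equivp weyl_rel"
proof (rule equivpI)
  show "reflp weyl_rel" by (simp add: reflp_def weyl_rel_def weyl_ideal.zero)
  show "symp weyl_rel"
    unfolding symp_def weyl_rel_def using weyl_ideal_uminus by fastforce
  show "transp weyl_rel"
    unfolding transp_def weyl_rel_def using weyl_ideal.add by fastforce
qed

quotient_type (overloaded) ('n, 'k) weyl = "('n, 'k::field) free_weyl" / weyl_rel
  by (rule equivp_weyl_rel)

instantiation weyl :: (type, field) ring_1
begin

lift_definition zero_weyl :: "('a, 'b) weyl" is 0 .

lift_definition one_weyl :: "('a, 'b) weyl" is 1 .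

lift_definition plus_weyl :: "('a, 'b) weyl \<Rightarrow> ('a, 'b) weyl \<Rightarrow> ('a, 'b) weyl" is "(+)"
  unfolding weyl_rel_def by (metis add_diff_add weyl_ideal.add)

lift_definition uminus_weyl :: "('a, 'b) weyl \<Rightarrow> ('a, 'b) weyl" is uminus
  unfolding weyl_rel_def using weyl_ideal_uminus by fastforce

lift_definition minus_weyl :: "('a, 'b) weyl \<Rightarrow> ('a, 'b) weyl \<Rightarrow> ('a, 'b) weyl" is "(-)"
proof -
  fix p p' q q' :: "('a, 'b) free_weyl"
  assume "weyl_rel p p'" "weyl_rel q q'"
  then have "(p - p') + - (q - q') \<in> weyl_ideal"
    unfolding weyl_rel_def by (intro weyl_ideal.add weyl_ideal_uminus)
  then show "weyl_rel (p - q) (p' - q')"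
    unfolding weyl_rel_def by (simp add: algebra_simps)
qed

lift_definition times_weyl :: "('a, 'b) weyl \<Rightarrow> ('a, 'b) weyl \<Rightarrow> ('a, 'b) weyl" is "(*)"
proof -
  fix p p' q q' :: "('a, 'b) free_weyl"
  assume "weyl_rel p p'" "weyl_rel q q'"
  then have "(p - p') * q + p' * (q - q') \<in> weyl_ideal"
    unfolding weyl_rel_def
    by (intro weyl_ideal.add weyl_ideal_mult_left weyl_ideal_mult_right)
  then show "weyl_rel (p * q) (p' * q')"
    unfolding weyl_rel_def by (simp add: algebra_simps)
qed

instance
proof
  fix a b c :: "('a, 'b) weyl"
  show "(0 :: ('a, 'b) weyl) \<noteq> 1"
    by transfer
      (use one_notin_weyl_ideal weyl_ideal_uminus in \<open>fastforce simp: weyl_rel_def\<close>)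
  show "a + b + c = a + (b + c)"
    by transfer (simp add: add.assoc weyl_rel_def weyl_ideal.zero)
  show "a + b = b + a" by transfer (simp add: add.commute weyl_rel_def weyl_ideal.zero)
  show "0 + a = a" by transfer (simp add: weyl_rel_def weyl_ideal.zero)
  show "- a + a = 0" by transfer (simp add: weyl_rel_def weyl_ideal.zero)
  show "a - b = a + - b" by transfer (simp add: weyl_rel_def weyl_ideal.zero)
  show "a * b * c = a * (b * c)"
    by transfer (simp add: mult.assoc weyl_rel_def weyl_ideal.zero)
  show "1 * a = a" by transfer (simp add: weyl_rel_def weyl_ideal.zero)
  show "a * 1 = a" by transfer (simp add: weyl_rel_def weyl_ideal.zero)
  show "(a + b) * c = a * c + b * c"
    by transfer (simp add: distrib_right weyl_rel_def weyl_ideal.zero)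
  show "a * (b + c) = a * b + a * c"
    by transfer (simp add: distrib_left weyl_rel_def weyl_ideal.zero)
qed

end

lift_definition weyl_scalar :: "'k::field \<Rightarrow> ('n, 'k) weyl" is "Poly_Mapping.single 0" .

lemma single_0_central:
  fixes p :: "'g::monoid_add \<Rightarrow>\<^sub>0 'k::comm_ring_1"
  shows "Poly_Mapping.single 0 c * p = p * Poly_Mapping.single 0 c"
proof (induction p rule: update_induct)
  case const
  then show ?case by simp
next
  case (update f a b)
  then show ?case
    using update by (simp add: update_eq_add_single distrib_left distrib_right mult_single mult.commute)
qed

interpretation weyl: unital_algebra "weyl_scalar :: 'k::field \<Rightarrow> ('n, 'k) weyl"
proof
  fix c d :: 'k and a :: "('n, 'k) weyl"
  show "weyl_scalar (c + d) = (weyl_scalar c + weyl_scalar d :: ('n, 'k) weyl)"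
    by transfer (simp add: single_add weyl_rel_def weyl_ideal.zero)
  show "weyl_scalar (c * d) = (weyl_scalar c * weyl_scalar d :: ('n, 'k) weyl)"
    by transfer (simp add: mult_single weyl_rel_def weyl_ideal.zero)
  show "weyl_scalar 1 = (1 :: ('n, 'k) weyl)"
    by transfer (simp add: weyl_rel_def weyl_ideal.zero)
  show "weyl_scalar c * a = a * weyl_scalar c"
    by transfer (simp add: single_0_central weyl_rel_def weyl_ideal.zero)
qed

end

(*
  Let x = x_0 and let A be the Weyl algebra in the remaining variables. For an element w of A[x],
  A[x] becomes a module over the whole Weyl algebra if A and x act by left multiplication and
  d/dx acts by m |-> m' + m w; its submodules are the left ideals stable under the derivation
  d/dx - [w, .]. For a suitable quadratic w, with coefficients in K[x], this derivation becomes on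
  symbols a Shamsuddin derivation of a polynomial ring,
    d/dx + SUM_i (x^i q_i + 1) d/dq_i + SUM_i (1 - x^i xi_i) d/dxi_i.
  A nonzero K[x]-submodule stable under it contains 1, by comparing coefficients of an element with
  lexicographically least leading monomial. Introducing the symbol xi_i of d/dq_i for only r of the
  n - 1 indices i, and letting d/dq_i act on polynomials for the others, gives an irreducible module
  on a polynomial ring in n + r variables, whose Gelfand-Kirillov dimension is n + r.
*)
theory Submission
  imports Defs "HOL-Real_Asymp.Real_Asymp"
begin

section \<open>Representations of the Weyl algebra\<close>

text \<open>Here w = SUM_{i <= r} (q_i - d/dq_i - x^i q_i d/dq_i). Being quadratic, it has a
  commutator that acts on symbols by a vector field, without terms of higher order. Its linear part
  gives the constants 1 in the coefficients of that field; without them the ideals generated by q_i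
  or by xi_i would be stable. Its quadratic part scales q_i by x^i and xi_i by -x^i. For i > r
  nothing has to be added to the action of d/dx, since (x^i q_i + 1) d/dq_i already lies in the Weyl
  algebra. The obstacle is that the two variables of a pair are scaled by the same power of x, so
  that their contributions could cancel when coefficients are compared. The opposite signs exclude
  this, and different pairs are separated by different powers of x. All these powers are positive,
  so that scaling strictly raises the degree in x.\<close>

context unital_algebra
begin

lemma emb_zero: "emb 0 = 0"
  using emb_add[of 0 0] by simp

lemma emb_uminus: "emb (- c) = - emb c"
  using emb_add[of c "- c"] by (simp add: emb_zero eq_neg_iff_add_eq_0 add.commute)

lemma scale_mult: "(emb c * a) * (emb d * b) = emb (c * d) * (a * b)"
  by (metis emb_central emb_mult mult.assoc)

fun word_eval :: "('n weyl_gen \<Rightarrow> 'a) \<Rightarrow> 'n weyl_gen word \<Rightarrow> 'a" where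
  "word_eval T (Word gs) = prod_list (map T gs)"

lemma word_eval_plus: "word_eval T (u + v) = word_eval T u * word_eval T v"
  by (cases u; cases v) simp

definition free_eval :: "('n weyl_gen \<Rightarrow> 'a) \<Rightarrow> ('n, 'k) free_weyl \<Rightarrow> 'a" where
  "free_eval T p = (\<Sum>w\<in>Poly_Mapping.keys p. emb (Poly_Mapping.lookup p w) * word_eval T w)"

lemma free_eval_superset:
  assumes "finite A" "Poly_Mapping.keys p \<subseteq> A"
  shows "free_eval T p = (\<Sum>w\<in>A. emb (Poly_Mapping.lookup p w) * word_eval T w)"
  unfolding free_eval_def
  by (rule sum.mono_neutral_left) (use assms in \<open>auto simp: in_keys_iff emb_zero\<close>)

lemma free_eval_add: "free_eval T (p + q) = free_eval T p + free_eval T q"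
  using Poly_Mapping.keys_add[of p q]
  by (simp add: free_eval_superset[of "Poly_Mapping.keys p \<union> Poly_Mapping.keys q"] lookup_add
      emb_add distrib_right sum.distrib)

lemma free_eval_single: "free_eval T (Poly_Mapping.single w c) = emb c * word_eval T w"
  by (auto simp: free_eval_def emb_zero)

lemma free_eval_zero: "free_eval T 0 = 0"
  by (simp add: free_eval_def)

lemma free_eval_diff: "free_eval T (p - q) = free_eval T p - free_eval T q"
  using free_eval_add[of T "p - q" q] by simp

lemma free_eval_one: "free_eval T 1 = 1"
  by (simp add: free_eval_single zero_word_def emb_one flip: single_one)

lemma free_eval_gen: "free_eval T (free_gen g) = T g"
  by (simp add: free_gen_def free_eval_single emb_one)

lemma free_eval_mult: "free_eval T (p * q) = free_eval T p * free_eval T q"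
proof (induction p rule: update_induct)
  case const
  show ?case by (simp add: free_eval_zero)
next
  case (update p u c)
  have "free_eval T (Poly_Mapping.single u c * q) = emb c * word_eval T u * free_eval T q"
  proof (induction q rule: update_induct)
    case const
    show ?case by (simp add: free_eval_zero)
  next
    case (update q v b)
    then show ?case
      by (simp add: update_eq_add_single distrib_left free_eval_add free_eval_single mult_single
          word_eval_plus scale_mult)
  qed
  with update show ?case
    by (simp add: update_eq_add_single distrib_right free_eval_add free_eval_single)
qed

definition weyl_family :: "('n weyl_gen \<Rightarrow> 'a) \<Rightarrow> bool" where
  "weyl_family T \<longleftrightarrow>
     (\<forall>i j. T (GX i) * T (GX j) = T (GX j) * T (GX i)) \<and>
     (\<forall>i j. T (GD i) * T (GD j) = T (GD j) * T (GD i)) \<and>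
     (\<forall>i j. T (GD i) * T (GX j) - T (GX j) * T (GD i) = (if i = j then 1 else 0))"

lemma free_eval_relator:
  assumes "weyl_family T" "r \<in> weyl_relators"
  shows "free_eval T r = 0"
proof -
  have "T (GD i) * T (GX j) - T (GX j) * T (GD i) = (if i = j then 1 else 0)" for i j
    using assms(1) by (simp add: weyl_family_def)
  moreover have "free_eval T (if i = j then 1 else 0) = (if i = j then 1 else 0)" for i j :: 'b
    by (simp add: free_eval_one free_eval_zero)
  ultimately show ?thesis
    using assms unfolding weyl_relators_def weyl_family_def
    by (auto simp: free_eval_diff free_eval_mult free_eval_gen)
qed

lemma free_eval_ideal:
  assumes "weyl_family T" "p \<in> weyl_ideal"
  shows "free_eval T p = 0"
  using assms(2)
  by (induction rule: weyl_ideal.induct)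
    (simp_all add: free_eval_zero free_eval_add free_eval_mult free_eval_relator[OF assms(1)])

text \<open>A chosen representative makes this total in \<open>T\<close>; independence of the choice
  holds only when \<open>T\<close> satisfies the Weyl relations.\<close>

definition weyl_eval :: "('n weyl_gen \<Rightarrow> 'a) \<Rightarrow> ('n, 'k) weyl \<Rightarrow> 'a" where
  "weyl_eval T a = free_eval T (rep_weyl a)"

lemma weyl_eval_abs:
  assumes "weyl_family T"
  shows "weyl_eval T (abs_weyl p) = free_eval T p"
proof -
  have "weyl_rel (rep_weyl (abs_weyl p)) p"
    using Quotient_rep_abs[OF Quotient_weyl] equivp_reflp[OF equivp_weyl_rel] by blast
  then show ?thesis
    using free_eval_ideal[OF assms] unfolding weyl_eval_def weyl_rel_def
    by (metis eq_iff_diff_eq_0 free_eval_diff)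
qed

end

lemma abs_weyl_rep: "abs_weyl (rep_weyl a) = a"
  using Quotient_abs_rep[OF Quotient_weyl] .

lemma weyl_abs_cases: obtains p where "a = abs_weyl p"
  by (metis abs_weyl_rep)

definition weyl_gen :: "'n weyl_gen \<Rightarrow> ('n, 'k::field) weyl" where
  "weyl_gen g = abs_weyl (free_gen g)"

context unital_algebra
begin

lemma weyl_eval_hom:
  assumes "weyl_family T"
  shows "weyl_eval T (a + b) = weyl_eval T a + weyl_eval T b"
    and "weyl_eval T (a * b) = weyl_eval T a * weyl_eval T b"
    and "weyl_eval T (weyl_scalar c) = emb c"
    and "weyl_eval T (weyl_gen g) = T g"
proof -
  obtain p q where pq: "a = abs_weyl p" "b = abs_weyl q"
    by (metis weyl_abs_cases)
  show "weyl_eval T (a + b) = weyl_eval T a + weyl_eval T b"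
    using assms pq by (simp add: plus_weyl.abs_eq weyl_eval_abs free_eval_add)
  show "weyl_eval T (a * b) = weyl_eval T a * weyl_eval T b"
    using assms pq by (simp add: times_weyl.abs_eq weyl_eval_abs free_eval_mult)
  show "weyl_eval T (weyl_scalar c) = emb c"
    using assms by (simp add: weyl_scalar.abs_eq weyl_eval_abs free_eval_single zero_word_def)
  show "weyl_eval T (weyl_gen g) = T g"
    using assms by (simp add: weyl_gen_def weyl_eval_abs free_eval_gen)
qed

end

lemma weyl_gen_family: "weyl.weyl_family (weyl_gen :: 'n weyl_gen \<Rightarrow> ('n, 'k::field) weyl)"
proof -
  have rel: "r \<in> weyl_relators \<Longrightarrow> abs_weyl r = 0" for r :: "('n, 'k) free_weyl"
    using weyl_ideal.gen[of r 1 1] by (simp add: zero_weyl.abs_eq weyl.abs_eq_iff weyl_rel_def)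
  have xx: "abs_weyl (free_comm (GX i) (GX j) :: ('n, 'k) free_weyl) = 0"
    and dd: "abs_weyl (free_comm (GD i) (GD j) :: ('n, 'k) free_weyl) = 0"
    and dx: "abs_weyl (free_comm (GD i) (GX j) - (if i = j then 1 else 0) :: ('n, 'k) free_weyl) = 0"
    for i j :: 'n
    by (rule rel, unfold weyl_relators_def, blast)+
  have "abs_weyl (if i = j then 1 else 0 :: ('n, 'k) free_weyl) = (if i = j then 1 else 0)" for i j :: 'n
    by (simp add: zero_weyl.abs_eq one_weyl.abs_eq)
  then show ?thesis
    using xx dd dx unfolding weyl.weyl_family_def weyl_gen_def
    by (simp flip: minus_weyl.abs_eq times_weyl.abs_eq)
qed

text \<open>Every element is a sum of scaled words, and words are products of generators. This
  carries closure properties from the generators to the whole algebra.\<close>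

lemma weyl_induct [case_names scalar gen add mult]:
  fixes a :: "('n, 'k::field) weyl"
  assumes scalar: "\<And>c. P (weyl_scalar c)" and gen: "\<And>g. P (weyl_gen g)"
    and add: "\<And>a b. P a \<Longrightarrow> P b \<Longrightarrow> P (a + b)" and mult: "\<And>a b. P a \<Longrightarrow> P b \<Longrightarrow> P (a * b)"
  shows "P a"
proof -
  have word: "P (abs_weyl (Poly_Mapping.single (Word gs) c))" for gs and c :: 'k
  proof (induction gs)
    case Nil
    show ?case using scalar by (simp add: weyl_scalar.abs_eq zero_word_def)
  next
    case (Cons g gs)
    have "Poly_Mapping.single (Word (g # gs)) c = free_gen g * Poly_Mapping.single (Word gs) c"
      by (simp add: free_gen_def mult_single)
    then show ?case
      using mult[OF gen[of g] Cons] by (simp add: times_weyl.abs_eq weyl_gen_def)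
  qed
  have "P (abs_weyl p)" for p :: "('n, 'k) free_weyl"
  proof (induction p rule: update_induct)
    case const
    show ?case using word[of _ 0] by simp
  next
    case (update p u c)
    then show ?case
      using add[OF update(3) word] by (cases u) (simp add: update_eq_add_single plus_weyl.abs_eq)
  qed
  then show ?thesis by (metis abs_weyl_rep)
qed

text \<open>A function on exponents is read as the family of coefficients of a formal power series.
  Polynomials are singled out later by a condition on the support.\<close>

lift_definition weyl_op :: "('n, 'k::field) weyl \<Rightarrow> (('n \<Rightarrow> nat) \<Rightarrow> 'k) \<Rightarrow> ('n \<Rightarrow> nat) \<Rightarrow> 'k" is free_op
proof -
  fix p q :: "('n, 'k) free_weyl"
  assume "weyl_rel p q"
  then show "free_op p = free_op q"
    using free_op_ideal[of "p - q"] by (simp add: weyl_rel_def free_op_diff fun_eq_iff)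
qed

lemma weyl_op_add: "weyl_op (a + b) f m = weyl_op a f m + weyl_op b f m"
  by transfer (simp add: free_op_add)

lemma weyl_op_diff: "weyl_op (a - b) f m = weyl_op a f m - weyl_op b f m"
  by transfer (simp add: free_op_diff)

lemma weyl_op_mult: "weyl_op (a * b) f = weyl_op a (weyl_op b f)"
  by transfer (simp add: free_op_mult)

lemma weyl_op_scalar: "weyl_op (weyl_scalar c) f m = c * f m"
  by transfer (simp add: free_op_single zero_word_def)

lemma weyl_op_zero: "weyl_op 0 f m = 0"
  by transfer (simp add: free_op_zero)

lemma weyl_op_one: "weyl_op 1 f = f"
  by transfer (simp add: free_op_one)

lemma weyl_op_gen: "weyl_op (weyl_gen g) f = gen_op g f"
  unfolding weyl_gen_def by transfer (simp add: free_op_gen)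

lemma weyl_op_sum: "weyl_op (sum a I) f m = (\<Sum>i\<in>I. weyl_op (a i) f m)"
  by (induction I rule: infinite_finite_induct) (simp_all add: weyl_op_add weyl_op_zero)

lemma weyl_op_linear:
  "weyl_op p (\<lambda>m. a * f m + b * h m) m = a * weyl_op p f m + b * weyl_op p h m"
  by transfer (simp add: free_op_def word_op_linear distrib_left sum.distrib sum_distrib_left
      mult.left_commute)

section \<open>Lexicographically minimal exponents\<close>

text \<open>The largest index decides, so x, at index 0, weighs least: a change at any other index
  outweighs every change of the exponent of x.\<close>

definition lexl :: "(nat \<Rightarrow> nat) \<Rightarrow> (nat \<Rightarrow> nat) \<Rightarrow> bool" where
  "lexl u v \<longleftrightarrow> (\<exists>l. u l < v l \<and> (\<forall>m>l. u m = v m))"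

lemma lexl_irrefl: "\<not> lexl v v"
  by (simp add: lexl_def)

lemma lexl_asym:
  assumes "lexl u v" "lexl v u"
  shows False
proof -
  obtain l l' where "u l < v l" "\<forall>m>l. u m = v m" "v l' < u l'" "\<forall>m>l'. v m = u m"
    using assms by (auto simp: lexl_def)
  then show False by (cases l l' rule: linorder_cases) auto
qed

lemma lexl_trans:
  assumes "lexl u v" "lexl v w"
  shows "lexl u w"
proof -
  obtain l l' where "u l < v l" "\<forall>m>l. u m = v m" "v l' < w l'" "\<forall>m>l'. v m = w m"
    using assms by (auto simp: lexl_def)
  then show ?thesis
    unfolding lexl_def by (intro exI[of _ "max l l'"]) (cases l l' rule: linorder_cases, auto)
qed

lemma lexl_upd: "v l < k \<Longrightarrow> lexl v (v(l := k))"
  unfolding lexl_def by (intro exI[of _ l]) auto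

lemma lexl_of_le:
  assumes "\<And>m. u m \<le> v m" "u \<noteq> v" "\<And>m. m \<ge> N \<Longrightarrow> v m = 0"
  shows "lexl u v"
proof -
  let ?A = "{m. u m \<noteq> v m}"
  have "?A \<subseteq> {..<N}" using assms(1,3) by (metis (mono_tags) le_zero_eq lessThan_iff mem_Collect_eq not_less subsetI)
  then have fin: "finite ?A" using finite_subset by blast
  have ne: "?A \<noteq> {}" using assms(2) by auto
  have "u (Max ?A) \<noteq> v (Max ?A)" using Max_in[OF fin ne] by simp
  moreover have "u m = v m" if "m > Max ?A" for m
    using Max_ge[OF fin, of m] that by fastforce
  ultimately show ?thesis
    unfolding lexl_def using assms(1) by (metis le_neq_implies_less)
qed

text \<open>Induction on the number of free coordinates: keep the exponents that are maximal at the
  last free coordinate and recurse on them.\<close>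

lemma lexl_greatest:
  assumes "finite A" "A \<noteq> {}" "\<And>u v l. u \<in> A \<Longrightarrow> v \<in> A \<Longrightarrow> l \<ge> N \<Longrightarrow> u l = v l"
  shows "\<exists>v\<in>A. \<forall>u\<in>A. u = v \<or> lexl u v"
  using assms
proof (induction N arbitrary: A)
  case 0
  then show ?case by (metis ext all_not_in_conv le0)
next
  case (Suc N)
  define M where "M = Max ((\<lambda>v. v N) ` A)"
  define A' where "A' = {v \<in> A. v N = M}"
  have M: "v N \<le> M" if "v \<in> A" for v
    using Suc.prems(1) that by (auto simp: M_def)
  have "M \<in> (\<lambda>v. v N) ` A"
    unfolding M_def using Suc.prems by (intro Max_in) auto
  then have "A' \<noteq> {}" "finite A'" using Suc.prems(1) by (auto simp: A'_def)
  moreover have "u l = v l" if "u \<in> A'" "v \<in> A'" "l \<ge> N" for u v l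
    using that Suc.prems(3)[of u v l] by (cases "l = N") (auto simp: A'_def)
  ultimately obtain v where v: "v \<in> A'" "\<forall>u\<in>A'. u = v \<or> lexl u v"
    using Suc.IH[of A'] by blast
  have "u = v \<or> lexl u v" if "u \<in> A" for u
  proof (cases "u N = M")
    case True
    then show ?thesis using v that by (auto simp: A'_def)
  next
    case False
    then have "u N < v N" using M[OF that] v(1) by (auto simp: A'_def)
    moreover have "u m = v m" if "m > N" for m
      using Suc.prems(3)[OF \<open>u \<in> A\<close>, of v m] v(1) that by (auto simp: A'_def)
    ultimately show ?thesis by (auto simp: lexl_def)
  qed
  then show ?case using v(1) by (auto simp: A'_def)
qed

text \<open>With finitely many free coordinates \<open>lexl\<close> is a well-order, so that
  \<open>A\<close> may be infinite, as the set of leading exponents of a submodule may be.\<close>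

lemma lexl_least:
  assumes "A \<noteq> {}" "\<And>u v l. u \<in> A \<Longrightarrow> v \<in> A \<Longrightarrow> l \<ge> N \<Longrightarrow> u l = v l"
  shows "\<exists>v\<in>A. \<forall>u\<in>A. u = v \<or> lexl v u"
  using assms
proof (induction N arbitrary: A)
  case 0
  then show ?case by (metis ext all_not_in_conv le0)
next
  case (Suc N)
  define M where "M = (LEAST k. k \<in> (\<lambda>v. v N) ` A)"
  define A' where "A' = {v \<in> A. v N = M}"
  have M: "M \<le> v N" if "v \<in> A" for v
    unfolding M_def using that by (intro Least_le) auto
  have "M \<in> (\<lambda>v. v N) ` A"
    unfolding M_def using Suc.prems(1) by (metis LeastI ex_in_conv image_eqI)
  then have "A' \<noteq> {}" by (auto simp: A'_def)
  moreover have "u l = v l" if "u \<in> A'" "v \<in> A'" "l \<ge> N" for u v l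
    using that Suc.prems(2)[of u v l] by (cases "l = N") (auto simp: A'_def)
  ultimately obtain v where v: "v \<in> A'" "\<forall>u\<in>A'. u = v \<or> lexl v u"
    using Suc.IH[of A'] by blast
  have "u = v \<or> lexl v u" if "u \<in> A" for u
  proof (cases "u N = M")
    case True
    then show ?thesis using v that by (auto simp: A'_def)
  next
    case False
    then have "v N < u N" using M[OF that] v(1) by (auto simp: A'_def)
    moreover have "v m = u m" if "m > N" for m
      using Suc.prems(2)[OF \<open>u \<in> A\<close>, of v m] v(1) that by (auto simp: A'_def)
    ultimately show ?thesis by (auto simp: lexl_def)
  qed
  then show ?case using v(1) by (auto simp: A'_def)
qed

lemma finite_set_ex_max:
  fixes w :: "'a \<Rightarrow> nat"
  assumes "finite A" "A \<noteq> {}"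
  obtains a where "a \<in> A" "\<And>b. b \<in> A \<Longrightarrow> w b \<le> w a"
proof -
  have "Max (w ` A) \<in> w ` A" using assms by (intro Max_in) auto
  then obtain a where "a \<in> A" "w a = Max (w ` A)" by auto
  then show ?thesis using that assms by simp
qed

section \<open>The Shamsuddin module\<close>

definition comm :: "'a::ring_1 \<Rightarrow> 'a \<Rightarrow> bool" where
  "comm a b \<longleftrightarrow> a * b = b * a"

lemma comm_sym: "comm a b \<Longrightarrow> comm b a"
  by (simp add: comm_def)

lemma comm_one: "comm a 1"
  by (simp add: comm_def)

lemma comm_add: "comm a b \<Longrightarrow> comm a c \<Longrightarrow> comm a (b + c)"
  by (simp add: comm_def algebra_simps)

lemma comm_diff: "comm a b \<Longrightarrow> comm a c \<Longrightarrow> comm a (b - c)"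
  by (simp add: comm_def algebra_simps)

lemma comm_mult:
  assumes "comm a b" "comm a c"
  shows "comm a (b * c)"
proof -
  have "a * (b * c) = b * (a * c)" using assms(1) by (simp add: comm_def flip: mult.assoc)
  also have "\<dots> = b * c * a" using assms(2) by (simp add: comm_def mult.assoc)
  finally show ?thesis by (simp add: comm_def)
qed

lemma comm_power: "comm a b \<Longrightarrow> comm a (b ^ k)"
  by (induction k) (simp_all add: comm_one comm_mult)

lemma comm_sum: "(\<And>i. i \<in> I \<Longrightarrow> comm a (f i)) \<Longrightarrow> comm a (sum f I)"
  by (simp add: comm_def sum_distrib_left sum_distrib_right)

lemmas comm_intros = comm_one comm_add comm_diff comm_mult comm_power comm_sum

abbreviation wx :: "'n \<Rightarrow> ('n, 'k::field) weyl" where "wx i \<equiv> weyl_gen (GX i)"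
abbreviation wd :: "'n \<Rightarrow> ('n, 'k::field) weyl" where "wd i \<equiv> weyl_gen (GD i)"

lemma comm_weyl_gen:
  fixes i j :: 'n
  shows "comm (wx i) (wx j :: ('n, 'k::field) weyl)"
    and "comm (wd i) (wd j :: ('n, 'k) weyl)"
    and "i \<noteq> j \<Longrightarrow> comm (wd i) (wx j :: ('n, 'k) weyl)"
    and "i \<noteq> j \<Longrightarrow> comm (wx i) (wd j :: ('n, 'k) weyl)"
proof -
  note fam = weyl_gen_family[where 'n='n and 'k='k, unfolded weyl.weyl_family_def]
  note d = fam[THEN conjunct2, THEN conjunct2, rule_format]
  show "comm (wx i) (wx j :: ('n, 'k) weyl)"
    unfolding comm_def by (rule fam[THEN conjunct1, rule_format])
  show "comm (wd i) (wd j :: ('n, 'k) weyl)"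
    unfolding comm_def by (rule fam[THEN conjunct2, THEN conjunct1, rule_format])
  show "i \<noteq> j \<Longrightarrow> comm (wd i) (wx j :: ('n, 'k) weyl)" using d[of i j] by (simp add: comm_def)
  show "i \<noteq> j \<Longrightarrow> comm (wx i) (wd j :: ('n, 'k) weyl)" using d[of j i] by (simp add: comm_def)
qed

lemma wd_wx: "wd i * wx i = wx i * wd i + 1"
  using weyl_gen_family[where 'n='a and 'k='b] unfolding weyl.weyl_family_def
  by (metis add.commute diff_add_cancel)

lemma weyl_op_wx_power:
  "weyl_op (wx l ^ k) f e = (if e l < k then 0 else f (e(l := e l - k)))"
  by (induction k arbitrary: e) (auto simp: weyl_op_one weyl_op_mult weyl_op_gen)

lemma weyl_op_euler: "weyl_op (wx l * wd l) f e = of_nat (e l) * f e"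
  by (cases "e l") (auto simp: weyl_op_mult weyl_op_gen fun_upd_idem)

locale shamsuddin =
  fixes n r :: nat
  assumes r_less: "r < n"
begin

text \<open>
  Variable $0$ is $x$, variable $i$ with $1 \le i < n$ is $q_i$, and variable $n - 1 + i$ with
  $1 \le i \le r$ is $\xi_i$. On symbols, left multiplication by the $i$-th derivation is
  $\partial_{q_i} + \xi_i$, while $q_i + \partial_{\xi_i}$ and $\xi_i$ are the right multiplications
  by $q_i$ and by that derivation.
\<close>

definition D0 :: "(nat, 'k::field) weyl" where
  "D0 = wd 0 + (\<Sum>i\<in>{1..r}.
     (1 - wx 0 ^ i * wx (n - 1 + i)) * (wx i + wd (n - 1 + i)) - wx (n - 1 + i))"

definition D :: "nat \<Rightarrow> (nat, 'k::field) weyl" where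
  "D i = (if i = 0 then D0 else wd i + (if i \<le> r then wx (n - 1 + i) else 0))"

text \<open>
  Adding left multiplications turns \<^term>\<open>D0\<close> into a derivation of the polynomial ring.
\<close>

definition \<Delta> :: "(nat, 'k::field) weyl" where
  "\<Delta> = D0 + (\<Sum>i\<in>{1..<n}. (wx 0 ^ i * wx i + 1) * D i) - (\<Sum>i\<in>{1..r}. wx i)"

lemma comm_wx_D:
  assumes "i < n" "l < n" "i \<noteq> l"
  shows "comm (wx l) (D i)"
proof (cases "i = 0")
  case True
  then show ?thesis
    using assms unfolding D_def D0_def by (auto intro!: comm_intros comm_weyl_gen)
next
  case False
  then show ?thesis
    using assms unfolding D_def by (auto intro!: comm_intros comm_weyl_gen simp: comm_def[of _ 0])
qed

text \<open>Only the summand \<open>wd i\<close> of \<open>D i\<close> fails to commute with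
  \<open>wx i\<close>.\<close>

lemma D_wx:
  assumes "i < n"
  shows "D i * wx i - wx i * D i = 1"
proof (cases "i = 0")
  case True
  define s :: "(nat, 'a) weyl" where "s = (\<Sum>i\<in>{1..r}.
     (1 - wx 0 ^ i * wx (n - 1 + i)) * (wx i + wd (n - 1 + i)) - wx (n - 1 + i))"
  have "comm (wx 0) s"
    using r_less unfolding s_def by (auto intro!: comm_intros comm_weyl_gen)
  then show ?thesis
    using True wd_wx[of 0] unfolding D_def D0_def s_def[symmetric] comm_def by (simp add: algebra_simps)
next
  case False
  have "comm (wx i) (if i \<le> r then wx (n - 1 + i) else 0 :: (nat, 'a) weyl)"
    by (auto intro!: comm_weyl_gen simp: comm_def[of _ 0])
  then show ?thesis
    using False wd_wx[of i] unfolding D_def comm_def by (simp add: algebra_simps)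
qed

text \<open>Left multiplications commute with right ones: apart from x and d/dx, \<open>D0\<close>
  is built from right multiplications by q_l and d/dq_l, while \<open>D i\<close> is a left
  multiplication.\<close>

lemma comm_D0_D:
  assumes "0 < i" "i < n"
  shows "comm (D i) (D0 :: (nat, 'a::field) weyl)"
proof -
  have D: "comm (D i) a" if "comm (wd i) a" "comm (wx (n - 1 + i)) a" for a :: "(nat, 'a) weyl"
    using that assms by (auto simp: D_def comm_def algebra_simps)
  have Dx: "comm (D i) (wx l :: (nat, 'a) weyl)" if "l \<noteq> i" for l
    using that assms by (intro D comm_weyl_gen) auto
  have Dd: "comm (D i) (wd l :: (nat, 'a) weyl)" if "l \<noteq> n - 1 + i" for l
    using that assms by (intro D comm_weyl_gen) auto
  \<comment> \<open>For l = i the two nonzero commutators, [d/dq_i, q_i] = 1 and [xi_i, d/dxi_i] =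
    -1, cancel.\<close>
  have DY: "comm (D i) (wx l + wd (n - 1 + l) :: (nat, 'a) weyl)" if "l \<in> {1..r}" for l
  proof (cases "l = i")
    case True
    have "comm (D i) (wx i + wd (n - 1 + i) :: (nat, 'a) weyl)"
    proof -
      have c: "comm (wd i) (wd (n - 1 + i) :: (nat, 'a) weyl)"
          "comm (wx (n - 1 + i)) (wx i :: (nat, 'a) weyl)"
        by (intro comm_weyl_gen)+
      show ?thesis
        using c wd_wx[of i, where 'b='a] wd_wx[of "n - 1 + i", where 'b='a] that True assms
        unfolding D_def comm_def by (simp add: algebra_simps)
    qed
    with True show ?thesis by simp
  next
    case False
    then show ?thesis using that by (intro comm_add Dx Dd) auto
  qed
  show ?thesis
    unfolding D0_def
    by (intro comm_add comm_sum comm_diff comm_mult comm_one comm_power DY Dx Dd) (use assms in auto)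
qed

lemma comm_D_D:
  assumes "i < n" "l < n"
  shows "comm (D i) (D l)"
proof -
  consider "i = 0" "l = 0" | "0 < i" "l = 0" | "i = 0" "0 < l" | "0 < i" "0 < l" by auto
  then show ?thesis
  proof cases
    case 4
    have "comm (wd i) (D l)" "comm (wx (n - 1 + i)) (D l)" if "i \<noteq> l"
      using assms 4 that by (auto simp: D_def intro!: comm_intros comm_weyl_gen simp: comm_def[of _ 0])
    then show ?thesis using 4
      by (cases "i = l") (auto simp: comm_def D_def[of i] algebra_simps)
  qed (use assms comm_D0_D in \<open>auto simp: D_def[of 0] intro: comm_sym simp: comm_def[of D0 D0]\<close>)
qed

text \<open>The target is a Weyl algebra with variables numbered by naturals, so that the Weyl
  relations for the new action are identities between its elements. \<open>\<iota>\<close> numbers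
  the original variables.\<close>

definition rep :: "('n \<Rightarrow> nat) \<Rightarrow> 'n weyl_gen \<Rightarrow> (nat, 'k::field) weyl" where
  "rep \<iota> g = (case g of GX i \<Rightarrow> wx (\<iota> i) | GD i \<Rightarrow> D (\<iota> i))"

lemma weyl_family_rep:
  assumes "inj \<iota>" "range \<iota> \<subseteq> {..<n}"
  shows "weyl.weyl_family (rep \<iota>)"
proof -
  have less: "\<iota> i < n" for i using assms(2) by auto
  have "D (\<iota> i) * wx (\<iota> j) - wx (\<iota> j) * D (\<iota> i) = (if i = j then 1 else 0 :: (nat, 'b) weyl)" for i j
    using comm_wx_D[OF less less, of i j, where 'a='b] D_wx[OF less, of i, where 'a='b]
      inj_eq[OF assms(1), of i j]
    by (auto simp: comm_def)
  then show ?thesis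
    using comm_D_D[OF less less, where 'a='b] comm_weyl_gen(1)[where 'n=nat and 'k='b]
    unfolding weyl.weyl_family_def rep_def comm_def by simp
qed

text \<open>Left and right multiplication by w have the same part of order zero on symbols, so their
  difference leaves a pure vector field.\<close>

lemma \<Delta>_eq:
  "\<Delta> = wd 0 + (\<Sum>i\<in>{1..<n}. (wx 0 ^ i * wx i + 1) * wd i)
      + (\<Sum>i\<in>{1..r}. (1 - wx 0 ^ i * wx (n - 1 + i)) * wd (n - 1 + i))"
proof -
  have "(\<Sum>i\<in>{1..<n}. (wx 0 ^ i * wx i + 1) * D i) =
      (\<Sum>i\<in>{1..<n}. (wx 0 ^ i * wx i + 1) * wd i) +
      (\<Sum>i\<in>{1..<n}. if i \<le> r then (wx 0 ^ i * wx i + 1) * wx (n - 1 + i) else 0 :: (nat, 'a) weyl)"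
    unfolding sum.distrib[symmetric] by (rule sum.cong) (auto simp: D_def algebra_simps)
  also have "(\<Sum>i\<in>{1..<n}. if i \<le> r then (wx 0 ^ i * wx i + 1) * wx (n - 1 + i) else 0) =
      (\<Sum>i\<in>{1..r}. (wx 0 ^ i * wx i + 1) * wx (n - 1 + i) :: (nat, 'a) weyl)"
    using r_less by (intro sum.mono_neutral_cong_right) auto
  finally have "\<Delta> = wd 0 + (\<Sum>i\<in>{1..<n}. (wx 0 ^ i * wx i + 1) * wd i) +
     (\<Sum>i\<in>{1..r}. ((1 - wx 0 ^ i * wx (n - 1 + i)) * (wx i + wd (n - 1 + i)) - wx (n - 1 + i))
        + (wx 0 ^ i * wx i + 1) * wx (n - 1 + i) - wx i :: (nat, 'a) weyl)"
    unfolding \<Delta>_def D0_def by (simp add: sum.distrib sum_subtractf)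
  \<comment> \<open>The terms without a derivation are (1 - x^i xi_i) q_i - xi_i + (x^i q_i + 1)
    xi_i - q_i = 0.\<close>
  moreover have "((1 - wx 0 ^ i * wx (n - 1 + i)) * (wx i + wd (n - 1 + i)) - wx (n - 1 + i))
        + (wx 0 ^ i * wx i + 1) * wx (n - 1 + i) - wx i
      = (1 - wx 0 ^ i * wx (n - 1 + i)) * (wd (n - 1 + i) :: (nat, 'a) weyl)" for i
    using comm_weyl_gen(1)[of "n - 1 + i" i, where 'k='a] unfolding comm_def
    by (simp add: algebra_simps mult.assoc)
  ultimately show ?thesis by simp
qed

text \<open>
  The operator $\Delta$ scales variable \<open>l\<close> by \<open>eps l * x ^ kap l\<close>.
\<close>

definition kap :: "nat \<Rightarrow> nat" where
  "kap l = (if l < n then l else l - (n - 1))"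

definition eps :: "nat \<Rightarrow> 'k::field" where
  "eps l = (if l < n then 1 else - 1)"

text \<open>In terms of coefficients: the first two summands are the partial derivatives, and the
  last comes from the Euler operators, which multiply a coefficient by its exponent, followed by a
  shift in x.\<close>

lemma weyl_op_\<Delta>:
  "weyl_op \<Delta> f e = of_nat (Suc (e 0)) * f (e(0 := Suc (e 0)))
     + (\<Sum>l\<in>{1..<n + r}. of_nat (Suc (e l)) * f (e(l := Suc (e l))))
     + (\<Sum>l\<in>{1..<n + r}. if e 0 < kap l then 0 else eps l * of_nat (e l) * f (e(0 := e 0 - kap l)))"
proof -
  define P :: "nat \<Rightarrow> 'a" where "P l = of_nat (Suc (e l)) * f (e(l := Suc (e l)))" for l
  define Q :: "nat \<Rightarrow> 'a" where
    "Q l = (if e 0 < kap l then 0 else eps l * of_nat (e l) * f (e(0 := e 0 - kap l)))" for l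
  have op: "weyl_op (wx 0 ^ k * (wx l * wd l)) f e =
      (if e 0 < k then 0 else of_nat (e l) * f (e(0 := e 0 - k)))" if "l \<noteq> 0" for k l
    using that by (simp add: weyl_op_mult[of "wx 0 ^ k"] weyl_op_wx_power weyl_op_euler)
  have q: "weyl_op ((wx 0 ^ i * wx i + 1) * wd i) f e = P i + Q i" if "i \<in> {1..<n}" for i
    using that op[of i i]
    by (simp add: distrib_right weyl_op_add mult.assoc weyl_op_gen P_def Q_def kap_def eps_def)
  have p: "weyl_op ((1 - wx 0 ^ i * wx (n - 1 + i)) * wd (n - 1 + i)) f e =
      P (n - 1 + i) + Q (n - 1 + i)" if "i \<in> {1..r}" for i
    using that op[of "n - 1 + i" i]
    by (auto simp: left_diff_distrib weyl_op_diff mult.assoc weyl_op_gen P_def Q_def kap_def eps_def)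
  have "(\<Sum>i\<in>{1..r}. P (n - 1 + i) + Q (n - 1 + i)) = (\<Sum>l\<in>{n..<n + r}. P l + Q l)"
    using r_less by (intro sum.reindex_bij_witness[of _ "\<lambda>l. l - (n - 1)" "\<lambda>i. n - 1 + i"]) auto
  moreover have "(\<Sum>l\<in>{1..<n + r}. P l + Q l) = (\<Sum>l\<in>{1..<n}. P l + Q l) + (\<Sum>l\<in>{n..<n + r}. P l + Q l)"
    using r_less by (simp add: sum.atLeastLessThan_concat)
  ultimately have "weyl_op \<Delta> f e = weyl_op (wd 0) f e + (\<Sum>l\<in>{1..<n + r}. P l + Q l)"
    unfolding \<Delta>_eq weyl_op_add weyl_op_sum by (simp add: q p add.assoc del: One_nat_def)
  then show ?thesis
    by (simp add: weyl_op_gen sum.distrib P_def Q_def)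
qed

end

section \<open>Polynomials, and nonzero constants in stable subspaces\<close>

context shamsuddin
begin

text \<open>Bounding every exponent separately, instead of the total degree, makes the number of
  monomials an exact power.\<close>

definition box :: "nat \<Rightarrow> (nat \<Rightarrow> nat) set" where
  "box t = {e. (\<forall>l<n + r. e l \<le> t) \<and> (\<forall>l\<ge>n + r. e l = 0)}"

lemma box_eq: "bij_betw (\<lambda>e l. if l < n + r then e l else 0) (PiE {..<n + r} (\<lambda>_. {..t})) (box t)"
proof (rule bij_betwI[where g = "\<lambda>e. restrict e {..<n + r}"])
qed (auto simp: box_def PiE_def extensional_def fun_eq_iff)

lemma finite_box: "finite (box t)"
  using box_eq[of t] finite_PiE[of "{..<n + r}" "\<lambda>_. {..t}"] by (simp add: bij_betw_finite)

lemma card_box: "card (box t) = (t + 1) ^ (n + r)"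
  using bij_betw_same_card[OF box_eq[of t]] by (simp add: card_PiE)

definition box_space :: "nat \<Rightarrow> ((nat \<Rightarrow> nat) \<Rightarrow> 'k::field) set" where
  "box_space t = {f. \<forall>e. f e \<noteq> 0 \<longrightarrow> e \<in> box t}"

definition polys :: "((nat \<Rightarrow> nat) \<Rightarrow> 'k::field) set" where
  "polys = (\<Union>t. box_space t)"

lemma polysD:
  assumes "f \<in> polys"
  shows "finite {e. f e \<noteq> 0}" and "f e \<noteq> 0 \<Longrightarrow> l \<ge> n + r \<Longrightarrow> e l = 0"
proof -
  obtain t where t: "f \<in> box_space t" using assms by (auto simp: polys_def)
  then have "{e. f e \<noteq> 0} \<subseteq> box t" by (auto simp: box_space_def)
  then show "finite {e. f e \<noteq> 0}" using finite_box finite_subset by blast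
  show "f e \<noteq> 0 \<Longrightarrow> l \<ge> n + r \<Longrightarrow> e l = 0" using t by (auto simp: box_space_def box_def)
qed

text \<open>
  \<^term>\<open>g\<close> is the result of applying to \<^term>\<open>f\<close> the operator \<^term>\<open>\<Delta>\<close> minus the polynomial
  in $x$ by which \<^term>\<open>\<Delta>\<close> multiplies the leading term of \<^term>\<open>f\<close>; it vanishes when the leading
  exponent \<^term>\<open>v\<close> is minimal.
\<close>

lemma minimal_relation:
  fixes f :: "(nat \<Rightarrow> nat) \<Rightarrow> 'k::field_char_0" and v :: "nat \<Rightarrow> nat"
  defines "g \<equiv> (\<lambda>e. of_nat (Suc (e 0)) * f (e(0 := Suc (e 0)))
     + (\<Sum>l\<in>{1..<n + r}. of_nat (Suc (e l)) * f (e(l := Suc (e l))))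
     + (\<Sum>l\<in>{1..<n + r}. if e 0 < kap l then 0
          else eps l * (of_nat (e l) - of_nat (v l)) * f (e(0 := e 0 - kap l))))"
  assumes f: "f \<in> polys" and fv: "f v \<noteq> 0" and above: "\<And>e. lexl v e \<Longrightarrow> f e = 0"
    and g: "\<And>e. g e = 0"
  shows "v = (\<lambda>l. 0)"
proof (rule ccontr)
  assume "v \<noteq> (\<lambda>l. 0)"
  have v0: "v 0 = 0"
  proof (rule ccontr)
    assume "v 0 \<noteq> 0"
    \<comment> \<open>Here only d/dx contributes, with \<open>v 0\<close> times the leading
      coefficient: raising another exponent leads above \<open>v\<close>, and the scaling
      coefficients vanish.\<close>
    define e where "e = v(0 := v 0 - 1)"
    have "f (e(l := Suc (e l))) = 0" if "l \<in> {1..<n + r}" for l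
    proof (rule above)
      show "lexl v (e(l := Suc (e l)))"
        using that unfolding lexl_def e_def by (intro exI[of _ l]) auto
    qed
    moreover have "e(0 := Suc (e 0)) = v" using \<open>v 0 \<noteq> 0\<close> by (auto simp: e_def)
    moreover have "(\<Sum>l\<in>{1..<n + r}. if e 0 < kap l then 0
          else eps l * (of_nat (e l) - of_nat (v l)) * f (e(0 := e 0 - kap l))) = 0"
      by (rule sum.neutral) (auto simp: e_def)
    ultimately show False
      using g[of e] fv \<open>v 0 \<noteq> 0\<close> unfolding g_def by (simp del: of_nat_Suc)
  qed
  define l0 where "l0 = (LEAST l. v l \<noteq> 0)"
  have l0: "v l0 \<noteq> 0"
    using \<open>v \<noteq> (\<lambda>l. 0)\<close> unfolding l0_def by (metis (mono_tags) LeastI ext)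
  have below: "v m = 0" if "m < l0" for m
    using not_less_Least that unfolding l0_def by blast
  have "l0 \<noteq> 0" using v0 l0 by metis
  have "l0 < n + r" using polysD(2)[OF f fv] l0 by (meson not_less)
  \<comment> \<open>On these exponents the relation involves, besides values that vanish, only \<^term>\<open>f\<close> on the
    same set and, at the single exponent just below \<^term>\<open>v\<close>, the value at \<^term>\<open>v\<close>.\<close>
  define C where "C = {e. (\<forall>m>l0. e m = v m) \<and> e l0 = v l0 - 1}"
  have C_up: "f (e(l := Suc (e l))) = 0"
    if "e \<in> C" "l > l0" for e l
    using that by (intro above) (auto simp: C_def lexl_def intro!: exI[of _ l])
  have C_below: "e(l := k) \<in> C" if "e \<in> C" "l < l0" for e l k
    using that by (auto simp: C_def)
  have C0: "f e = 0" if "e \<in> C" for e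
  proof (rule ccontr)
    assume "f e \<noteq> 0"
    define B where "B = {e \<in> C. f e \<noteq> 0}"
    have "finite B" unfolding B_def using polysD(1)[OF f] by (rule rev_finite_subset) auto
    have "B \<noteq> {}" using that \<open>f e \<noteq> 0\<close> by (auto simp: B_def)
    \<comment> \<open>The extremal exponent maximises the degree in the variables strictly between x
      and \<open>l0\<close>, and only then the exponent of x. Since \<open>tdeg\<close> ignores x,
      \<open>t_max\<close> holds for every exponent of x.\<close>
    define tdeg :: "(nat \<Rightarrow> nat) \<Rightarrow> nat" where "tdeg e = (\<Sum>m\<in>{1..<l0}. e m)" for e
    obtain e1 where e1: "e1 \<in> B" "\<And>e. e \<in> B \<Longrightarrow> tdeg e \<le> tdeg e1"
      using finite_set_ex_max[OF \<open>finite B\<close> \<open>B \<noteq> {}\<close>, of tdeg] by blast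
    define B' where "B' = {e \<in> B. tdeg e = tdeg e1}"
    have "finite B'" "B' \<noteq> {}" using \<open>finite B\<close> e1 by (auto simp: B'_def)
    then obtain e where e: "e \<in> B'" "\<And>e'. e' \<in> B' \<Longrightarrow> e' 0 \<le> e 0"
      using finite_set_ex_max[of B' "\<lambda>e. e 0"] by blast
    have eC: "e \<in> C" and fe: "f e \<noteq> 0" using e(1) by (auto simp: B'_def B_def)
    have x_max: "f (e(0 := k)) = 0" if "k > e 0" for k
    proof (rule ccontr)
      assume "f (e(0 := k)) \<noteq> 0"
      then have "e(0 := k) \<in> B'"
        using e(1) C_below[OF eC, of 0 k] \<open>l0 \<noteq> 0\<close> by (auto simp: B'_def B_def tdeg_def)
      from e(2)[OF this] that show False by simp
    qed
    have t_max: "f (e(0 := k, l := Suc (e l))) = 0" if "l \<in> {1..<l0}" for k l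
    proof (rule ccontr)
      assume "f (e(0 := k, l := Suc (e l))) \<noteq> 0"
      then have "e(0 := k, l := Suc (e l)) \<in> B"
        using C_below[OF C_below[OF eC, of 0 k], of l "Suc (e l)"] that \<open>l0 \<noteq> 0\<close> by (auto simp: B_def)
      from e1(2)[OF this] have "tdeg (e(0 := k, l := Suc (e l))) \<le> tdeg e"
        using e(1) by (simp add: B'_def)
      moreover have "tdeg (e(0 := k, l := Suc (e l))) > tdeg e"
        unfolding tdeg_def using that by (intro sum_strict_mono_ex1) auto
      ultimately show False by simp
    qed
    define I where "I = {1..<n + r}"
    \<comment> \<open>\<open>d k\<close> is the coefficient of x^k in the difference of the
      polynomials by which the monomials \<open>e\<close> and \<open>v\<close> are scaled.\<close>
    define d :: "nat \<Rightarrow> 'k" where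
      "d k = (\<Sum>l\<in>{l\<in>I. kap l = k}. eps l * (of_nat (e l) - of_nat (v l)))" for k
    have l0I: "l0 \<in> I" using \<open>l0 \<noteq> 0\<close> \<open>l0 < n + r\<close> by (simp add: I_def)
    have el0: "eps l0 * (of_nat (e l0) - of_nat (v l0)) = (- eps l0 :: 'k)"
    proof -
      obtain m where "v l0 = Suc m" using l0 by (cases "v l0") auto
      then show ?thesis using eC by (simp add: C_def)
    qed
    have "d (kap l0) \<noteq> 0"
    proof -
      define R where "R = {l\<in>I. kap l = kap l0} - {l0}"
      have fin: "finite {l\<in>I. kap l = kap l0}" by (simp add: I_def)
      have d: "d (kap l0) = - eps l0 + (\<Sum>l\<in>R. eps l * (of_nat (e l) - of_nat (v l)))"
        unfolding d_def R_def by (subst sum.remove[OF fin, of l0]) (use l0I el0 in auto)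
      show ?thesis
      proof (cases "l0 < n")
        \<comment> \<open>The partner of some q_i is xi_i, if present. Its index is larger than
          \<open>l0\<close>, so \<open>e\<close> and \<open>v\<close> agree there and it contributes
          nothing.\<close>
        case True
        have "l > l0" if "l \<in> R" for l
          using that True by (auto simp: R_def I_def kap_def split: if_splits)
        then have "(\<Sum>l\<in>R. eps l * (of_nat (e l) - of_nat (v l)) :: 'k) = 0"
          using eC by (intro sum.neutral) (auto simp: C_def)
        with d True show ?thesis by (simp add: eps_def)
      next
        \<comment> \<open>The partner of xi_i is q_i, of smaller index, where \<open>v\<close>
          vanishes. Because of the opposite signs, xi_i contributes 1 and q_i a natural number, so
          the sum is nonzero in characteristic 0.\<close>
        case False
        have "l < n" "l < l0" if "l \<in> R" for l
          using that False by (auto simp: R_def I_def kap_def split: if_splits)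
        then have "(\<Sum>l\<in>R. eps l * (of_nat (e l) - of_nat (v l)) :: 'k) = of_nat (\<Sum>l\<in>R. e l)"
          unfolding of_nat_sum by (intro sum.cong) (auto simp: eps_def below)
        with d False have "d (kap l0) = of_nat (Suc (\<Sum>l\<in>R. e l))" by (simp add: eps_def)
        then show ?thesis by (simp del: of_nat_Suc)
      qed
    qed
    \<comment> \<open>The polynomial $\sum_k d_k x^k$ is not constant, so multiplying by it raises the $x$-degree of the
      coefficient at \<^term>\<open>e\<close>, which no other term of the relation can compensate.\<close>
    define Z where "Z = {k \<in> kap ` I. d k \<noteq> 0}"
    have Z: "finite Z" "Z \<noteq> {}" using \<open>d (kap l0) \<noteq> 0\<close> l0I by (auto simp: Z_def I_def)
    define K where "K = Max Z"
    have K: "K \<in> kap ` I" "d K \<noteq> 0" using Max_in[OF Z] by (auto simp: K_def Z_def)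
    have K_max: "d k = 0" if "k \<in> kap ` I" "k > K" for k
      using Max_ge[OF Z(1), of k] that by (auto simp: K_def Z_def)
    have "K \<ge> 1" using K(1) by (auto simp: I_def kap_def)
    define e' where "e' = e(0 := e 0 + K)"
    define F where "F k = (if e 0 + K < k then 0 else f (e(0 := e 0 + K - k)))" for k
    have e'C: "e' \<in> C" unfolding e'_def using C_below eC \<open>l0 \<noteq> 0\<close> by blast
    have "f (e'(0 := Suc (e' 0))) = 0"
      using x_max[of "Suc (e 0 + K)"] by (simp add: e'_def)
    moreover have "f (e'(l := Suc (e' l))) = 0" if "l \<in> I" for l
    proof (cases l l0 rule: linorder_cases)
      case less
      then show ?thesis using that t_max[of l "e 0 + K"] by (simp add: e'_def I_def)
    next
      case equal
      \<comment> \<open>Raising the exponent at \<open>l0\<close> restores \<open>v l0\<close>; the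
        exponent is then at least \<open>v\<close> everywhere and strictly larger at x, because
        \<open>K\<close> is positive and \<open>v 0 = 0\<close>.\<close>
      have "lexl v (e'(l0 := Suc (e' l0)))"
      proof (rule lexl_of_le[where N = "n + r"])
        show "v m \<le> (e'(l0 := Suc (e' l0))) m" for m
          using e'C below[of m] by (cases m l0 rule: linorder_cases) (auto simp: C_def)
        show "v \<noteq> e'(l0 := Suc (e' l0))"
          using v0 \<open>K \<ge> 1\<close> \<open>l0 \<noteq> 0\<close> by (auto simp: e'_def fun_eq_iff intro!: exI[of _ 0])
        show "(e'(l0 := Suc (e' l0))) m = 0" if "m \<ge> n + r" for m
          using that polysD(2)[OF f fe that] \<open>l0 < n + r\<close> by (auto simp: e'_def)
      qed
      with equal show ?thesis using above by simp
    next
      case greater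
      then show ?thesis using C_up[OF e'C] by simp
    qed
    ultimately have "(\<Sum>l\<in>I. if e' 0 < kap l then 0
          else eps l * (of_nat (e' l) - of_nat (v l)) * f (e'(0 := e' 0 - kap l))) = 0"
      using g[of e'] unfolding g_def I_def by simp
    also have "(\<Sum>l\<in>I. if e' 0 < kap l then 0
          else eps l * (of_nat (e' l) - of_nat (v l)) * f (e'(0 := e' 0 - kap l)))
        = (\<Sum>l\<in>I. eps l * (of_nat (e l) - of_nat (v l)) * F (kap l))"
      by (rule sum.cong) (auto simp: e'_def F_def I_def)
    also have "\<dots> = (\<Sum>k\<in>kap ` I. \<Sum>l\<in>{l\<in>I. kap l = k}. eps l * (of_nat (e l) - of_nat (v l)) * F (kap l))"
      by (rule sum.image_gen) (simp add: I_def)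
    also have "\<dots> = (\<Sum>k\<in>kap ` I. d k * F k)"
      by (rule sum.cong) (auto simp: d_def sum_distrib_right intro!: sum.cong)
    also have "\<dots> = d K * F K"
    proof -
      have "d k * F k = 0" if "k \<in> kap ` I" "k \<noteq> K" for k
        using that K_max[of k] x_max[of "e 0 + K - k"] by (cases k K rule: linorder_cases) (auto simp: F_def)
      then have "(\<Sum>k\<in>kap ` I. d k * F k) = (\<Sum>k\<in>{K}. d k * F k)"
        using K(1) by (intro sum.mono_neutral_right) (auto simp: I_def)
      then show ?thesis by simp
    qed
    finally show False using K(2) fe by (simp add: F_def)
  qed
  define e where "e = v(l0 := v l0 - 1)"
  have eC: "e \<in> C" by (auto simp: C_def e_def)
  have "f (e(0 := Suc (e 0))) = 0" using C0 C_below[OF eC] \<open>l0 \<noteq> 0\<close> by blast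
  moreover have "(\<Sum>l\<in>{1..<n + r}. of_nat (Suc (e l)) * f (e(l := Suc (e l))))
      = (\<Sum>l\<in>{l0}. of_nat (Suc (e l)) * f (e(l := Suc (e l))))"
  proof (rule sum.mono_neutral_right)
    show "\<forall>l\<in>{1..<n + r} - {l0}. of_nat (Suc (e l)) * f (e(l := Suc (e l))) = 0"
      using C0 C_below[OF eC] C_up[OF eC] by (metis DiffD2 insertI1 linorder_neqE_nat mult_zero_right)
  qed (use \<open>l0 \<noteq> 0\<close> \<open>l0 < n + r\<close> in auto)
  moreover have "e(l0 := Suc (e l0)) = v" using l0 by (auto simp: e_def)
  moreover have "(\<Sum>l\<in>{1..<n + r}. if e 0 < kap l then 0
          else eps l * (of_nat (e l) - of_nat (v l)) * f (e(0 := e 0 - kap l))) = 0"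
    using C0 C_below[OF eC] \<open>l0 \<noteq> 0\<close> by (intro sum.neutral) auto
  ultimately show False
    using g[of e] fv unfolding g_def by (simp del: of_nat_Suc)
qed

text \<open>Stability under x and \<open>\<Delta>\<close> allows the scaling of the leading term to
  be subtracted. What remains has a smaller leading exponent, hence vanishes by minimality, and
  \<open>minimal_relation\<close> applies.\<close>

lemma exists_constant:
  fixes L :: "((nat \<Rightarrow> nat) \<Rightarrow> 'k::field_char_0) set"
  assumes polys: "L \<subseteq> polys" and add: "\<And>f h. f \<in> L \<Longrightarrow> h \<in> L \<Longrightarrow> (\<lambda>e. f e + h e) \<in> L"
    and scalar: "\<And>c f. f \<in> L \<Longrightarrow> weyl_op (weyl_scalar c) f \<in> L"
    and x: "\<And>f. f \<in> L \<Longrightarrow> weyl_op (wx 0) f \<in> L"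
    and \<Delta>: "\<And>f. f \<in> L \<Longrightarrow> weyl_op \<Delta> f \<in> L"
    and ne: "f \<in> L" "f e \<noteq> 0"
  shows "\<exists>g\<in>L. g (\<lambda>l. 0) \<noteq> 0 \<and> (\<forall>e. e \<noteq> (\<lambda>l. 0) \<longrightarrow> g e = 0)"
proof -
  have lead: "\<exists>v. g v \<noteq> 0 \<and> (\<forall>u. g u \<noteq> 0 \<longrightarrow> u = v \<or> lexl u v)" if "g \<in> L" "g e \<noteq> 0" for g e
  proof -
    have "g \<in> polys" using polys that(1) by blast
    note g = polysD[OF this]
    have "\<exists>v\<in>{e. g e \<noteq> 0}. \<forall>u\<in>{e. g e \<noteq> 0}. u = v \<or> lexl u v"
    proof (rule lexl_greatest[OF g(1), of "n + r"])
      show "{e. g e \<noteq> 0} \<noteq> {}" using that(2) by auto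
      show "u l = v l" if "u \<in> {e. g e \<noteq> 0}" "v \<in> {e. g e \<noteq> 0}" "l \<ge> n + r" for u v l
        using that g(2)[of u l] g(2)[of v l] by simp
    qed
    then show ?thesis by blast
  qed
  define P where "P = {v. \<exists>g\<in>L. g v \<noteq> 0 \<and> (\<forall>u. g u \<noteq> 0 \<longrightarrow> u = v \<or> lexl u v)}"
  have "P \<noteq> {}" using lead[OF ne] ne(1) by (auto simp: P_def)
  moreover have "u l = v l" if "u \<in> P" "v \<in> P" "l \<ge> n + r" for u v l
  proof -
    have z: "w l = 0" if "w \<in> P" for w
      using that polys polysD(2) \<open>l \<ge> n + r\<close> unfolding P_def by blast
    show ?thesis using z[of u] z[of v] that by simp
  qed
  ultimately obtain v where "v \<in> P" and v: "\<And>u. u \<in> P \<Longrightarrow> u = v \<or> lexl v u"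
    using lexl_least[of P "n + r"] by blast
  then obtain g where g: "g \<in> L" "g v \<noteq> 0" "\<And>u. g u \<noteq> 0 \<Longrightarrow> u = v \<or> lexl u v"
    by (auto simp: P_def)
  have above: "g u = 0" if "lexl v u" for u
    using g(3)[of u] lexl_asym[OF that] lexl_irrefl that by blast
  \<comment> \<open>The operators that preserve \<open>L\<close> are closed under sums and products,
    so they contain \<open>G\<close> along with x and \<open>\<Delta>\<close>.\<close>
  define St where "St = {a. \<forall>f\<in>L. weyl_op a f \<in> L}"
  have St_add: "a + b \<in> St" if "a \<in> St" "b \<in> St" for a b
  proof -
    have "weyl_op (a + b) f = (\<lambda>e. weyl_op a f e + weyl_op b f e)" for f
      by (simp add: fun_eq_iff weyl_op_add)
    then show ?thesis using that add by (simp add: St_def)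
  qed
  have St_mult: "a * b \<in> St" if "a \<in> St" "b \<in> St" for a b
    using that by (simp add: St_def weyl_op_mult)
  have St_scalar: "weyl_scalar c \<in> St" for c
    using scalar by (simp add: St_def)
  have St_power: "wx 0 ^ k \<in> St" for k
    using x St_scalar[of 1] by (induction k) (simp_all add: weyl.emb_one St_mult, simp add: St_def weyl_op_mult)
  have St_sum: "sum a I \<in> St" if "\<And>i. i \<in> I \<Longrightarrow> a i \<in> St" for a and I :: "nat set"
    using that St_scalar[of 0]
    by (induction I rule: infinite_finite_induct) (simp_all add: weyl.emb_zero St_add)
  \<comment> \<open>The monomial \<open>v\<close> is scaled by the sum of
    \<open>eps l * v l * x ^ kap l\<close>, which is subtracted.\<close>
  define G :: "(nat, 'k) weyl" where
    "G = \<Delta> + (\<Sum>l\<in>{1..<n + r}. weyl_scalar (- (eps l * of_nat (v l))) * wx 0 ^ kap l)"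
  have "\<Delta> \<in> St" using \<Delta> by (simp add: St_def)
  then have "G \<in> St"
    unfolding G_def by (intro St_add St_sum St_mult St_scalar St_power)
  then have "weyl_op G g \<in> L" using g(1) by (simp add: St_def)
  have G: "weyl_op G g e = of_nat (Suc (e 0)) * g (e(0 := Suc (e 0)))
     + (\<Sum>l\<in>{1..<n + r}. of_nat (Suc (e l)) * g (e(l := Suc (e l))))
     + (\<Sum>l\<in>{1..<n + r}. if e 0 < kap l then 0
          else eps l * (of_nat (e l) - of_nat (v l)) * g (e(0 := e 0 - kap l)))" for e
    unfolding G_def weyl_op_add weyl_op_sum weyl_op_\<Delta> weyl_op_mult weyl_op_scalar weyl_op_wx_power
      add.assoc sum.distrib[symmetric]
    by (intro arg_cong2[of _ _ _ _ "(+)"] refl sum.cong) (simp_all add: algebra_simps)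
  have g_raise: "g (w(l := k)) = 0" if "w = v \<or> lexl v w" "w l < k" for w l k
    using above lexl_upd[of w l k] lexl_trans that by blast
  \<comment> \<open>Derivatives lead to smaller exponents. A scaling term either starts from an
    exponent that agrees with \<open>v\<close> outside x, where its coefficient vanishes, or
    preserves the comparison with \<open>v\<close>, which is decided at an index above 0.\<close>
  have low: "lexl w v" if "weyl_op G g w \<noteq> 0" for w
  proof (rule ccontr)
    assume not: "\<not> lexl w v"
    have tot: "w = v \<or> lexl v w"
    proof -
      have "\<exists>z\<in>{v, w}. \<forall>u\<in>{v, w}. u = z \<or> lexl u z"
      proof (rule lexl_greatest[where N = "n + r"])
        have "v l = 0" "w l = 0" if "l \<ge> n + r" for l
          using polysD(2)[of g v l] polysD(2)[of "weyl_op G g" w l] g(1,2) that polys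
            \<open>weyl_op G g \<in> L\<close> \<open>weyl_op G g w \<noteq> 0\<close> by auto
        then show "u l = u' l" if "u \<in> {v, w}" "u' \<in> {v, w}" "l \<ge> n + r" for u u' l
          using that by auto
      qed auto
      then show ?thesis using not by auto
    qed
    have "(if w 0 < kap l then 0
          else eps l * (of_nat (w l) - of_nat (v l)) * g (w(0 := w 0 - kap l))) = 0"
      if "l \<in> {1..<n + r}" for l
    proof (cases "\<forall>m>0. w m = v m")
      case True
      then show ?thesis using that by simp
    next
      case False
      then obtain m where m: "m > 0" "w m \<noteq> v m" by blast
      then obtain p where p: "v p < w p" "\<forall>m>p. v m = w m" using tot by (auto simp: lexl_def)
      then have "p > 0" using m by (cases "p = 0") auto
      then have "lexl v (w(0 := w 0 - kap l))"
        using p unfolding lexl_def by (intro exI[of _ p]) auto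
      then show ?thesis using above by simp
    qed
    then have "weyl_op G g w = 0" unfolding G by (simp add: g_raise[OF tot])
    with that show False by blast
  qed
  have "weyl_op G g e = 0" for e
  proof (rule ccontr)
    assume "weyl_op G g e \<noteq> 0"
    with lead[of "weyl_op G g" e] \<open>weyl_op G g \<in> L\<close> obtain u where
      u: "weyl_op G g u \<noteq> 0" "\<forall>w. weyl_op G g w \<noteq> 0 \<longrightarrow> w = u \<or> lexl w u" by auto
    then have "u \<in> P" unfolding P_def mem_Collect_eq
      using \<open>weyl_op G g \<in> L\<close> by (intro bexI[of _ "weyl_op G g"] conjI)
    then show False using v[of u] low[OF u(1)] lexl_asym lexl_irrefl by blast
  qed
  then have v0: "v = (\<lambda>l. 0)"
    using minimal_relation[of g v] g(1,2) polys above G by auto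
  have "g e = 0" if "e \<noteq> (\<lambda>l. 0)" for e
    using g(3)[of e] that unfolding v0 by (auto simp: lexl_def)
  then show ?thesis using g v0 by blast
qed

end

section \<open>Growth\<close>

context vector_space
begin

text \<open>The finite spanning set guards against the convention that an infinite basis has
  cardinality 0.\<close>

lemma card_le_dim_of_finite_span:
  assumes "independent S" "S \<subseteq> U" "U \<subseteq> span T" "finite T"
  shows "card S \<le> dim U"
proof -
  obtain B where B: "B \<subseteq> U" "independent B" "U \<subseteq> span B" "card B = dim U"
    by (meson basis_exists)
  have "finite B" using independent_span_bound[OF \<open>finite T\<close> B(2)] B(1) assms(3) by blast
  then show ?thesis using independent_span_bound[OF _ assms(1), of B] assms(2) B by auto
qed

end

context algebra_left_module
begin

lemma act_zero_right: "act a 0 = 0"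
  using act_add_right[of a 0 0] by simp

lemma act_zero_left: "act 0 v = 0"
  using act_add_left[of 0 0 v] by simp

lemma act_emb_comm: "act a (act (emb c) v) = act (emb c) (act a v)"
  by (metis act_mult emb_central)

lemma subspace_subspace_power: "alg.subspace (subspace_power V m)"
  by (cases m) (simp_all add: alg.subspace_span)

lemma subspace_subspace_act: "mdl.subspace (subspace_act W F)"
  by (simp add: subspace_act_def mdl.subspace_span)

lemma mult_mem_subspace_power_Suc: "a \<in> V \<Longrightarrow> b \<in> subspace_power V m \<Longrightarrow> a * b \<in> subspace_power V (Suc m)"
  by (auto intro!: alg.span_base)

lemma mult_mem_subspace_power:
  assumes "a \<in> subspace_power V m" "b \<in> subspace_power V k"
  shows "a * b \<in> subspace_power V (m + k)"
  using assms(1)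
proof (induction m arbitrary: a)
  case 0
  then obtain c where "a = emb c" by (auto simp: alg.span_singleton)
  then show ?case
    using assms(2) subspace_subspace_power alg.subspace_scale by auto
next
  case (Suc m)
  have "a \<in> alg.span {a * b |a b. a \<in> V \<and> b \<in> subspace_power V m}" using Suc.prems by simp
  then show ?case
  proof (induction rule: alg.span_induct)
    case base
    then show ?case
      using alg.subspace_0[OF subspace_subspace_power] alg.subspace_add[OF subspace_subspace_power]
        alg.subspace_scale[OF subspace_subspace_power]
      by (auto simp: alg.subspace_def distrib_right mult.assoc simp del: subspace_power.simps)
  next
    case (step x)
    then show ?case using Suc.IH mult_mem_subspace_power_Suc by (auto simp: mult.assoc)
  qed
qed

lemma subspace_power_mono:
  assumes "1 \<in> V" "m \<le> k"
  shows "subspace_power V m \<subseteq> subspace_power V k"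
  using assms(2)
proof (induction rule: dec_induct)
  case (step k)
  then show ?case using mult_mem_subspace_power_Suc[OF assms(1)] by fastforce
qed simp

lemma act_mem_subspace_act:
  assumes "a \<in> subspace_power V m" "u \<in> subspace_act (subspace_power V k) F"
  shows "act a u \<in> subspace_act (subspace_power V (m + k)) F"
  using assms(2) unfolding subspace_act_def[of "subspace_power V k"]
proof (induction rule: mdl.span_induct)
  case base
  then show ?case
    using mdl.subspace_0[OF subspace_subspace_act] mdl.subspace_add[OF subspace_subspace_act]
      mdl.subspace_scale[OF subspace_subspace_act]
    by (auto simp: mdl.subspace_def act_add_right act_zero_right act_emb_comm)
next
  case (step x)
  then obtain b v where "x = act b v" "b \<in> subspace_power V k" "v \<in> F" by auto
  then show ?case
    using mult_mem_subspace_power[OF assms(1)] unfolding subspace_act_def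
    by (intro mdl.span_base) (auto simp flip: act_mult)
qed

lemma subspace_act_mono: "W \<subseteq> W' \<Longrightarrow> subspace_act W F \<subseteq> subspace_act W' F"
  unfolding subspace_act_def by (intro mdl.span_mono) auto

text \<open>Since 1 lies in \<open>V\<close>, the powers increase, so their union is a subalgebra
  containing \<open>V\<close>.\<close>

lemma ex_mem_subspace_power:
  assumes "alg_gen_subspace V"
  shows "\<exists>m. a \<in> subspace_power V m"
proof -
  have one: "1 \<in> V" using assms by (simp add: alg_gen_subspace_def)
  let ?S = "\<Union>m. subspace_power V m"
  have "subalgebra ?S"
    unfolding subalgebra_def
  proof (intro conjI ballI)
    show "alg.subspace ?S"
      unfolding alg.subspace_def
    proof (intro conjI ballI allI)
      show "0 \<in> ?S" using alg.subspace_0[OF subspace_subspace_power] by blast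
      show "x + y \<in> ?S" if xy: "x \<in> ?S" "y \<in> ?S" for x y
      proof -
        obtain m k where "x \<in> subspace_power V m" "y \<in> subspace_power V k" using xy by blast
        then have "x \<in> subspace_power V (m + k)" "y \<in> subspace_power V (m + k)"
          using subspace_power_mono[OF one, of m "m + k"] subspace_power_mono[OF one, of k "m + k"]
          by auto
        then show ?thesis using alg.subspace_add[OF subspace_subspace_power] by blast
      qed
      show "emb c * x \<in> ?S" if "x \<in> ?S" for c x
        using that alg.subspace_scale[OF subspace_subspace_power] by blast
    qed
    show "1 \<in> ?S" by (intro UN_I[of 0]) (simp_all add: alg.span_base)
    show "a * b \<in> ?S" if "a \<in> ?S" "b \<in> ?S" for a b
      using that mult_mem_subspace_power by blast
  qed
  moreover have "V \<subseteq> subspace_power V 1"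
    using mult_mem_subspace_power_Suc[of _ V 1 0] by (auto simp: alg.span_base)
  then have "V \<subseteq> ?S" by blast
  moreover have "subalgebra S \<and> V \<subseteq> S \<longrightarrow> S = UNIV" for S
    using assms by (simp add: alg_gen_subspace_def)
  ultimately have "?S = UNIV" by metis
  then show ?thesis by auto
qed

lemma ex_mem_subspace_act:
  assumes "alg_gen_subspace V" "mod_gen_subspace F"
  shows "\<exists>m. u \<in> subspace_act (subspace_power V m) F"
proof -
  have one: "1 \<in> V" using assms(1) by (simp add: alg_gen_subspace_def)
  let ?S = "\<Union>m. subspace_act (subspace_power V m) F"
  have "submodule ?S"
    unfolding submodule_def
  proof (intro conjI ballI allI)
    show "0 \<in> ?S" using mdl.subspace_0[OF subspace_subspace_act] by blast
    show "x + y \<in> ?S" if xy: "x \<in> ?S" "y \<in> ?S" for x y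
    proof -
      obtain m k where "x \<in> subspace_act (subspace_power V m) F"
        "y \<in> subspace_act (subspace_power V k) F" using xy by blast
      then have "x \<in> subspace_act (subspace_power V (m + k)) F"
        "y \<in> subspace_act (subspace_power V (m + k)) F"
        using subspace_act_mono[OF subspace_power_mono[OF one, of m "m + k"]]
          subspace_act_mono[OF subspace_power_mono[OF one, of k "m + k"]]
        by auto
      then show ?thesis using mdl.subspace_add[OF subspace_subspace_act] by blast
    qed
    show "act a x \<in> ?S" if xS: "x \<in> ?S" for a x
    proof -
      obtain m where m: "a \<in> subspace_power V m"
        using ex_mem_subspace_power[OF assms(1), of a] by (rule exE)
      obtain k where k: "x \<in> subspace_act (subspace_power V k) F"
        using xS by (rule UN_E)
      show ?thesis 
        using act_mem_subspace_act[OF m k] by (intro UN_I[where a = "m + k"]) simp_all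
    qed
  qed
  moreover have "F \<subseteq> subspace_act (subspace_power V 0) F"
  proof
    fix v assume "v \<in> F"
    then have "act 1 v \<in> subspace_act (subspace_power V 0) F"
      unfolding subspace_act_def by (intro mdl.span_base) (auto intro: alg.span_base)
    then show "v \<in> subspace_act (subspace_power V 0) F" by (simp add: act_one)
  qed
  then have "F \<subseteq> ?S" by blast
  moreover have "submodule S \<and> F \<subseteq> S \<longrightarrow> S = UNIV" for S
    using assms(2) by (simp add: mod_gen_subspace_def)
  ultimately have "?S = UNIV" by metis
  then show ?thesis by auto
qed

text \<open>Finitely many generators of the algebra have a common shift \<open>C\<close>, so the
  m-th power of \<open>V\<close> shifts by at most \<open>C * m\<close>; a finite generating set of
  the module lies in a single \<open>B b\<close>.\<close>

lemma filtration_bound: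
  assumes V: "alg_gen_subspace V" and F: "mod_gen_subspace F"
    and sub: "\<And>t. mdl.subspace (B t)" and mono: "\<And>s t. s \<le> t \<Longrightarrow> B s \<subseteq> B t"
    and union: "\<And>u. \<exists>t. u \<in> B t"
    and shift: "\<And>a. \<exists>c. \<forall>t. \<forall>u\<in>B t. act a u \<in> B (t + c)"
  shows "\<exists>a b. \<forall>m. subspace_act (subspace_power V m) F \<subseteq> B (a * m + b)"
proof -
  define Sh where "Sh c = {a. \<forall>t. \<forall>u\<in>B t. act a u \<in> B (t + c)}" for c :: nat
  have Sh_sub: "alg.subspace (Sh c)" for c
    unfolding alg.subspace_def Sh_def
    using mdl.subspace_0[OF sub] mdl.subspace_add[OF sub] mdl.subspace_scale[OF sub]
    by (auto simp: act_zero_left act_add_left act_mult)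
  have Sh_mono: "Sh c \<subseteq> Sh d" if "c \<le> d" for c d
    using mono[of "t + c" "t + d" for t] that unfolding Sh_def by fastforce
  obtain X where X: "finite X" "alg.span X = V" using V by (auto simp: alg_gen_subspace_def)
  obtain c where c: "\<And>a. a \<in> Sh (c a)"
    using shift unfolding Sh_def by simp metis
  define C where "C = Max (insert 0 (c ` X))"
  have "X \<subseteq> Sh C"
  proof
    fix a assume "a \<in> X"
    then have "c a \<le> C" using X(1) by (simp add: C_def)
    then show "a \<in> Sh C" using Sh_mono c by blast
  qed
  then have V_Sh: "V \<subseteq> Sh C" using alg.span_minimal[OF _ Sh_sub] X(2) by blast
  have power_Sh: "subspace_power V m \<subseteq> Sh (C * m)" for m
  proof (induction m)
    case 0
    have "1 \<in> Sh 0" by (simp add: Sh_def act_one)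
    then show ?case using alg.span_minimal[OF _ Sh_sub, of "{1}" 0] by simp
  next
    case (Suc m)
    have "a * b \<in> Sh (C * Suc m)" if aV: "a \<in> V" and bV: "b \<in> subspace_power V m" for a b
    proof -
      have "act b u \<in> B (t + C * m)" if "u \<in> B t" for t u
        using that bV Suc.IH by (auto simp: Sh_def)
      moreover have "act a u \<in> B (t + C)" if "u \<in> B t" for t u
        using that aV V_Sh by (auto simp: Sh_def)
      ultimately have "act a (act b u) \<in> B (t + C * m + C)" if "u \<in> B t" for t u
        using that by blast
      then show ?thesis by (simp add: Sh_def act_mult algebra_simps)
    qed
    then have "{a * b |a b. a \<in> V \<and> b \<in> subspace_power V m} \<subseteq> Sh (C * Suc m)" by blast
    from alg.span_minimal[OF this Sh_sub] show ?case by simp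
  qed
  obtain Y where Y: "finite Y" "mdl.span Y = F" using F by (auto simp: mod_gen_subspace_def)
  obtain t where t: "\<And>u. u \<in> B (t u)" using union by metis
  define b where "b = Max (insert 0 (t ` Y))"
  have "Y \<subseteq> B b"
  proof
    fix u assume "u \<in> Y"
    then have "t u \<le> b" using Y(1) by (simp add: b_def)
    then show "u \<in> B b" using mono t by blast
  qed
  then have F_B: "F \<subseteq> B b" using mdl.span_minimal[OF _ sub] Y(2) by blast
  have "subspace_act (subspace_power V m) F \<subseteq> B (C * m + b)" for m
    unfolding subspace_act_def
  proof (rule mdl.span_minimal[OF _ sub])
    show "{act a v |a v. a \<in> subspace_power V m \<and> v \<in> F} \<subseteq> B (C * m + b)"
      using power_Sh[of m] F_B by (auto simp: Sh_def add.commute)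
  qed
  then show ?thesis by blast
qed

end

text \<open>Between the j-th powers of two linear functions of m, the logarithm to base m converges
  to j, so the upper limit is a limit.\<close>

lemma limsup_log_polynomial_growth:
  fixes d :: "nat \<Rightarrow> nat" and a b c q j :: nat
  assumes upper: "\<And>m. d m \<le> (a * m + b) ^ j" and lower: "\<And>m. m \<ge> q \<Longrightarrow> m - q < c * e m"
    and de: "\<And>m. m \<ge> q \<Longrightarrow> e m ^ j \<le> d m"
  shows "limsup (\<lambda>m. ereal (log (real m) (real (d m)))) = ereal (real j)"
proof -
  \<comment> \<open>Adding 1 to \<open>a\<close>, and below to \<open>c\<close>, keeps the arguments
    of the logarithms positive for large m without a case distinction.\<close>
  define a' where "a' = real a + 1"
  define b' where "b' = real b"
  define c' where "c' = real c + 1"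
  define q' where "q' = real q"
  have pos: "a' > 0" "c' > 0" by (simp_all add: a'_def c'_def)
  have U: "(\<lambda>m. real j * log (real m) (a' * real m + b')) \<longlonglongrightarrow> real j * 1"
    unfolding log_def by (intro tendsto_mult tendsto_const) (use pos in real_asymp)
  have L: "(\<lambda>m. real j * log (real m) ((real m - q') / c')) \<longlonglongrightarrow> real j * 1"
    unfolding log_def by (intro tendsto_mult tendsto_const) (use pos in real_asymp)
  have "(\<lambda>m. log (real m) (real (d m))) \<longlonglongrightarrow> real j"
  proof (rule tendsto_sandwich)
    have low: "real j * log (real m) ((real m - q') / c') \<le> log (real m) (real (d m))
        \<and> log (real m) (real (d m)) \<le> real j * log (real m) (a' * real m + b')"
      if m: "m > q + 2" for m
    proof -
      have "m - q < c * e m" using lower m by simp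
      then have "real m - q' < real c * real (e m)"
        using m by (simp add: q'_def of_nat_diff flip: of_nat_mult)
      also have "\<dots> \<le> c' * real (e m)" by (simp add: c'_def distrib_right)
      finally have le: "(real m - q') / c' \<le> real (e m)"
        using pos by (simp add: field_simps)
      have p: "0 < (real m - q') / c'" using m pos by (simp add: q'_def)
      have "((real m - q') / c') ^ j \<le> real (e m) ^ j"
        using le p by (intro power_mono) auto
      also have "\<dots> \<le> real (d m)" using de[of m] m by (simp flip: of_nat_power)
      finally have lo: "((real m - q') / c') ^ j \<le> real (d m)" .
      have "real (d m) \<le> real ((a * m + b) ^ j)" using upper of_nat_le_iff by blast
      also have "\<dots> \<le> (a' * real m + b') ^ j"
        unfolding of_nat_power by (intro power_mono) (auto simp: a'_def b'_def algebra_simps)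
      finally have up: "real (d m) \<le> (a' * real m + b') ^ j" .
      have p': "0 < a' * real m + b'" using m pos by (intro add_pos_nonneg mult_pos_pos) (auto simp: b'_def)
      have m1: "real m > 1" using m by simp
      have pj: "0 < ((real m - q') / c') ^ j" using p by simp
      have "log (real m) (((real m - q') / c') ^ j) \<le> log (real m) (real (d m))"
        using lo pj m1 by (subst log_le_cancel_iff) auto
      moreover have "log (real m) (real (d m)) \<le> log (real m) ((a' * real m + b') ^ j)"
        using up lo pj m1 p' by (subst log_le_cancel_iff) auto
      ultimately show ?thesis using p p' m1 by (simp add: log_nat_power)
    qed
    show "\<forall>\<^sub>F m in sequentially. real j * log (real m) ((real m - q') / c') \<le> log (real m) (real (d m))"
      using eventually_gt_at_top[of "q + 2"] by eventually_elim (use low in blast)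
    show "\<forall>\<^sub>F m in sequentially. log (real m) (real (d m)) \<le> real j * log (real m) (a' * real m + b')"
      using eventually_gt_at_top[of "q + 2"] by eventually_elim (use low in blast)
    show "(\<lambda>m. real j * log (real m) ((real m - q') / c')) \<longlonglongrightarrow> real j" using L by simp
    show "(\<lambda>m. real j * log (real m) (a' * real m + b')) \<longlonglongrightarrow> real j" using U by simp
  qed
  then have "(\<lambda>m. ereal (log (real m) (real (d m)))) \<longlonglongrightarrow> ereal (real j)"
    by simp
  then show ?thesis
    by (intro lim_imp_Limsup) simp_all
qed

section \<open>Transport to the space of finitely supported sequences\<close>

context shamsuddin
begin

lemma box_mono: "s \<le> t \<Longrightarrow> box s \<subseteq> box t"
  by (auto simp: box_def intro: order_trans)

lemma box_space_mono: "s \<le> t \<Longrightarrow> box_space s \<subseteq> box_space t"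
  using box_mono unfolding box_space_def by blast

lemma box_space_linear: "f \<in> box_space t \<Longrightarrow> h \<in> box_space t \<Longrightarrow> (\<lambda>e. a * f e + b * h e) \<in> box_space t"
  unfolding box_space_def by (auto split: if_splits) (metis add.right_neutral mult_zero_right)

text \<open>The shift must not depend on \<open>t\<close>: this gives linear growth of the cubes,
  besides the invariance of the space of polynomials.\<close>

definition bounded_op :: "(nat, 'k::field) weyl \<Rightarrow> bool" where
  "bounded_op a \<longleftrightarrow> (\<exists>c. \<forall>t. \<forall>h\<in>box_space t. weyl_op a h \<in> box_space (t + c))"

lemma bounded_op_scalar: "bounded_op (weyl_scalar c)"
  unfolding bounded_op_def by (intro exI[of _ 0]) (auto simp: box_space_def weyl_op_scalar)

lemma bounded_op_add:
  assumes "bounded_op a" "bounded_op b"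
  shows "bounded_op (a + b)"
proof -
  obtain c d where c: "\<And>t h. h \<in> box_space t \<Longrightarrow> weyl_op a h \<in> box_space (t + c)"
    and d: "\<And>t h. h \<in> box_space t \<Longrightarrow> weyl_op b h \<in> box_space (t + d)"
    using assms unfolding bounded_op_def by metis
  have "weyl_op (a + b) h \<in> box_space (t + (c + d))" if "h \<in> box_space t" for t h
  proof -
    have "weyl_op a h \<in> box_space (t + (c + d))" "weyl_op b h \<in> box_space (t + (c + d))"
      using c[OF that] d[OF that] box_space_mono[of "t + c" "t + (c + d)"]
        box_space_mono[of "t + d" "t + (c + d)"] by auto
    from box_space_linear[OF this, of 1 1] show ?thesis
      by (simp add: weyl_op_add[abs_def])
  qed
  then show ?thesis unfolding bounded_op_def by blast
qed

lemma bounded_op_mult: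
  assumes "bounded_op a" "bounded_op b"
  shows "bounded_op (a * b)"
proof -
  obtain c d where c: "\<And>t h. h \<in> box_space t \<Longrightarrow> weyl_op a h \<in> box_space (t + c)"
    and d: "\<And>t h. h \<in> box_space t \<Longrightarrow> weyl_op b h \<in> box_space (t + d)"
    using assms unfolding bounded_op_def by metis
  have "weyl_op (a * b) h \<in> box_space (t + (d + c))" if "h \<in> box_space t" for t h
    using c[OF d[OF that]] by (simp add: weyl_op_mult add.assoc)
  then show ?thesis unfolding bounded_op_def by blast
qed

lemma bounded_op_one: "bounded_op 1"
  using bounded_op_scalar[of 1] by (simp add: weyl.emb_one)

lemma bounded_op_zero: "bounded_op 0"
  using bounded_op_scalar[of 0] by (simp add: weyl.emb_zero)

lemma bounded_op_diff:
  assumes "bounded_op a" "bounded_op b"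
  shows "bounded_op (a - b)"
  using bounded_op_add[OF assms(1) bounded_op_mult[OF bounded_op_scalar[of "- 1"] assms(2)]]
  by (simp add: weyl.emb_uminus weyl.emb_one)

lemma bounded_op_power: "bounded_op a \<Longrightarrow> bounded_op (a ^ k)"
  by (induction k) (simp_all add: bounded_op_one bounded_op_mult)

lemma bounded_op_sum: "(\<And>i. i \<in> I \<Longrightarrow> bounded_op (a i)) \<Longrightarrow> bounded_op (sum a I)"
  by (induction I rule: infinite_finite_induct) (simp_all add: bounded_op_zero bounded_op_add)

lemma bounded_op_wx:
  assumes "l < n + r"
  shows "bounded_op (wx l)"
proof -
  have "e \<in> box (t + 1)" if "e(l := e l - 1) \<in> box t" for e t
    using that assms unfolding box_def by (auto simp: le_diff_conv split: if_splits)
  then show ?thesis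
    unfolding bounded_op_def by (intro exI[of _ 1]) (auto simp: box_space_def weyl_op_gen)
qed

lemma bounded_op_wd: "bounded_op (wd l)"
proof -
  have "e \<in> box t" if "e(l := Suc (e l)) \<in> box t" for e t
    using that unfolding box_def by (auto split: if_splits)
  then show ?thesis
    unfolding bounded_op_def by (intro exI[of _ 0]) (auto simp: box_space_def weyl_op_gen)
qed

lemma bounded_op_D: "i < n \<Longrightarrow> bounded_op (D i)"
  unfolding D_def D0_def
  by (auto intro!: bounded_op_zero bounded_op_add bounded_op_sum bounded_op_diff bounded_op_mult
      bounded_op_one bounded_op_power bounded_op_wx bounded_op_wd)

end

text \<open>\<open>enc\<close> numbers the monomials in n + r variables, which identifies finitely
  supported sequences with polynomials; \<open>field_type\<close> names the field of
  coefficients.\<close>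

locale weyl_module = shamsuddin n r
  for n r :: nat +
  fixes field_type :: "'k::field_char_0 itself" and \<iota> :: "'n \<Rightarrow> nat" and enc :: "(nat \<Rightarrow> nat) \<Rightarrow> nat"
  assumes \<iota>: "bij_betw \<iota> UNIV {..<n}"
    and enc: "bij_betw enc {e. \<forall>l\<ge>n + r. e l = 0} UNIV"
begin

definition exps :: "(nat \<Rightarrow> nat) set" where
  "exps = {e. \<forall>l\<ge>n + r. e l = 0}"

lemma zero_exps: "(\<lambda>l. 0) \<in> exps"
  by (simp add: exps_def)

lemma inj_on_enc: "inj_on enc exps"
  using enc by (simp add: exps_def bij_betw_def)

lemma enc_surj: obtains e where "e \<in> exps" "m = enc e"
  using enc by (auto simp: exps_def bij_betw_def)

definition fun_of :: "(nat \<Rightarrow>\<^sub>0 'k) \<Rightarrow> (nat \<Rightarrow> nat) \<Rightarrow> 'k" where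
  "fun_of u e = (if e \<in> exps then Poly_Mapping.lookup u (enc e) else 0)"

lemma fun_of_eqI:
  assumes "fun_of u = fun_of v"
  shows "u = v"
proof (rule poly_mapping_eqI)
  fix m
  obtain e where "e \<in> exps" "m = enc e" by (rule enc_surj)
  then show "Poly_Mapping.lookup u m = Poly_Mapping.lookup v m"
    using fun_cong[OF assms, of e] by (simp add: fun_of_def)
qed

lemma fun_of_add: "fun_of (u + v) e = fun_of u e + fun_of v e"
  by (simp add: fun_of_def lookup_add)

lemma fun_of_zero: "fun_of 0 e = 0"
  by (simp add: fun_of_def)

lemma exps_box:
  assumes "e \<in> exps"
  shows "\<exists>t. e \<in> box t"
proof -
  have "e l \<le> sum e {..<n + r}" if "l < n + r" for l
    using that by (intro member_le_sum) auto
  then show ?thesis using assms unfolding exps_def box_def by blast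
qed

lemma fun_of_polys: "\<exists>t. fun_of u \<in> box_space t"
proof -
  have "finite {e \<in> exps. enc e \<in> Poly_Mapping.keys u}"
    using finite_vimage_IntI[OF _ inj_on_enc, of "Poly_Mapping.keys u"]
    by (simp add: vimage_def Int_def conj_commute)
  moreover have "{e \<in> exps. enc e \<in> Poly_Mapping.keys u} \<subseteq> {e. fun_of u e \<noteq> 0}"
    "{e. fun_of u e \<noteq> 0} \<subseteq> {e \<in> exps. enc e \<in> Poly_Mapping.keys u}"
    by (auto simp: fun_of_def in_keys_iff split: if_splits)
  ultimately have fin: "finite {e. fun_of u e \<noteq> 0}" by (meson finite_subset)
  have uniform: "\<exists>t. \<forall>e\<in>X. e \<in> box t" if "finite X" "X \<subseteq> exps" for X
    using that
  proof (induction X rule: finite_induct)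
    case (insert e X)
    then obtain s t where "\<forall>e\<in>X. e \<in> box s" "e \<in> box t" using exps_box[of e] by auto
    then show ?case
      using box_mono[of s "s + t"] box_mono[of t "s + t"] by (intro exI[of _ "s + t"]) auto
  qed auto
  have "{e. fun_of u e \<noteq> 0} \<subseteq> exps"
    by (auto simp: fun_of_def split: if_splits)
  from uniform[OF fin this] obtain t where "\<forall>e\<in>{e. fun_of u e \<noteq> 0}. e \<in> box t" by (rule exE)
  then have "fun_of u \<in> box_space t" by (simp add: box_space_def)
  then show ?thesis by (rule exI)
qed

definition of_fun :: "((nat \<Rightarrow> nat) \<Rightarrow> 'k) \<Rightarrow> (nat \<Rightarrow>\<^sub>0 'k)" where
  "of_fun h = (THE u. fun_of u = h)"

lemma fun_of_of_fun:
  assumes "h \<in> box_space t"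
  shows "fun_of (of_fun h) = h"
proof -
  define u where "u = Abs_poly_mapping (\<lambda>m. h (inv_into exps enc m))"
  have inv: "inv_into exps enc (enc e) = e" if "e \<in> exps" for e
    using that inj_on_enc by simp
  have box: "box t \<subseteq> exps" by (auto simp: box_def exps_def)
  have "{m. h (inv_into exps enc m) \<noteq> 0} \<subseteq> enc ` box t"
  proof
    fix m assume m: "m \<in> {m. h (inv_into exps enc m) \<noteq> 0}"
    obtain e where e: "e \<in> exps" "m = enc e" by (rule enc_surj)
    with m assms inv show "m \<in> enc ` box t" by (auto simp: box_space_def)
  qed
  then have "finite {m. h (inv_into exps enc m) \<noteq> 0}"
    using finite_box finite_subset by blast
  then have "Poly_Mapping.lookup u m = h (inv_into exps enc m)" for m
    by (simp add: u_def Abs_poly_mapping_inverse)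
  then have "fun_of u e = h e" for e
    using inv[of e] box assms by (cases "e \<in> exps") (auto simp: fun_of_def box_space_def)
  then have "fun_of u = h" by (rule ext)
  then show ?thesis
    unfolding of_fun_def by (rule theI) (use fun_of_eqI \<open>fun_of u = h\<close> in blast)
qed

definition act :: "('n, 'k) weyl \<Rightarrow> (nat \<Rightarrow>\<^sub>0 'k) \<Rightarrow> (nat \<Rightarrow>\<^sub>0 'k)" where
  "act a u = of_fun (weyl_op (weyl.weyl_eval (rep \<iota>) a) (fun_of u))"

lemma family: "weyl.weyl_family (rep \<iota> :: 'n weyl_gen \<Rightarrow> (nat, 'k) weyl)"
  using \<iota> by (intro weyl_family_rep) (auto simp: bij_betw_def)

lemmas eval_hom = weyl.weyl_eval_hom[OF family]

lemma \<iota>_less: "\<iota> i < n"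
  using \<iota> by (auto simp: bij_betw_def)

lemma \<iota>_surj:
  assumes "l < n"
  obtains i where "\<iota> i = l"
proof -
  have "l \<in> range \<iota>" using \<iota> assms by (simp add: bij_betw_def)
  then show ?thesis using that by blast
qed

lemma bounded_op_eval: "bounded_op (weyl.weyl_eval (rep \<iota>) a :: (nat, 'k) weyl)"
proof (induction a rule: weyl_induct)
  case (gen g)
  have "\<iota> i < n + r" for i using \<iota>_less[of i] by simp
  then have "bounded_op (rep \<iota> g :: (nat, 'k) weyl)"
    by (cases g) (simp_all add: rep_def bounded_op_wx bounded_op_D \<iota>_less)
  then show ?case by (simp add: eval_hom)
qed (simp_all add: eval_hom bounded_op_scalar bounded_op_add bounded_op_mult)

lemma fun_of_act: "fun_of (act a u) = weyl_op (weyl.weyl_eval (rep \<iota>) a) (fun_of u)"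
proof -
  obtain t where "fun_of u \<in> box_space t" using fun_of_polys by blast
  then obtain t' where "weyl_op (weyl.weyl_eval (rep \<iota>) a) (fun_of u) \<in> box_space t'"
    using bounded_op_eval[of a] unfolding bounded_op_def by blast
  then show ?thesis unfolding act_def by (rule fun_of_of_fun)
qed

lemma fun_of_act_scalar: "fun_of (act (weyl_scalar c) u) e = c * fun_of u e"
  by (simp add: fun_of_act eval_hom weyl_op_scalar)

lemma algebra_left_module_act: "algebra_left_module weyl_scalar act"
proof (intro algebra_left_module.intro weyl.unital_algebra_axioms left_module.intro)
  fix a b :: "('n, 'k) weyl" and u v :: "nat \<Rightarrow>\<^sub>0 'k"
  have "weyl_op p (fun_of (u + v)) e = weyl_op p (fun_of u) e + weyl_op p (fun_of v) e" for p e
    using weyl_op_linear[of p 1 "fun_of u" 1 "fun_of v" e] by (simp add: fun_of_add[abs_def])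
  then show "act a (u + v) = act a u + act a v"
    by (intro fun_of_eqI) (simp add: fun_eq_iff fun_of_act fun_of_add)
  show "act (a + b) v = act a v + act b v"
    by (intro fun_of_eqI) (simp add: fun_eq_iff fun_of_act fun_of_add eval_hom weyl_op_add)
  show "act (a * b) v = act a (act b v)"
    by (intro fun_of_eqI) (simp add: fun_eq_iff fun_of_act eval_hom weyl_op_mult)
  show "act 1 v = v"
    using fun_of_act_scalar[of 1 v] by (intro fun_of_eqI) (simp add: fun_eq_iff weyl.emb_one)
qed

sublocale M: algebra_left_module "weyl_scalar :: 'k \<Rightarrow> ('n, 'k) weyl" act
  by (rule algebra_left_module_act)

definition bv :: "(nat \<Rightarrow> nat) \<Rightarrow> (nat \<Rightarrow>\<^sub>0 'k)" where
  "bv e = Poly_Mapping.single (enc e) 1"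

lemma fun_of_single:
  "e \<in> exps \<Longrightarrow> fun_of (Poly_Mapping.single (enc e) c) e' = (if e' = e then c else 0)"
  using inj_on_enc by (auto simp: fun_of_def lookup_single when_def inj_on_def)

lemma fun_of_bv: "e \<in> exps \<Longrightarrow> fun_of (bv e) e' = (if e' = e then 1 else 0)"
  by (simp add: bv_def fun_of_single)

definition deg :: "(nat \<Rightarrow> nat) \<Rightarrow> nat" where
  "deg e = (\<Sum>l<n + r. e l)"

text \<open>A monomial containing x or some q_i is a coordinate times a smaller one. Otherwise it is
  a product of xi_i, and on such products \<open>D i\<close> is multiplication by xi_i, because
  d/dq_i annihilates them.\<close>

lemma bv_step:
  assumes e: "e \<in> exps" "e \<noteq> (\<lambda>l. 0)"
  shows "\<exists>g. \<exists>e'\<in>exps. Suc (deg e') = deg e \<and> act (weyl_gen g) (bv e') = bv e"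
proof -
  have lower: "e(l := e l - 1) \<in> exps \<and> Suc (deg (e(l := e l - 1))) = deg e" if "e l \<noteq> 0" for l
  proof -
    have "l < n + r" using e(1) that by (metis (mono_tags) exps_def mem_Collect_eq not_less)
    then have "deg e' = e' l + (\<Sum>l\<in>{..<n + r} - {l}. e' l)" for e'
      unfolding deg_def by (intro sum.remove) auto
    then show ?thesis using e(1) that by (simp add: exps_def)
  qed
  have wx: "weyl_op (wx l) (fun_of (bv (e(l := e l - 1)))) = fun_of (bv e)" if "e l \<noteq> 0" for l
  proof
    fix e'
    have eq: "e'(l := e' l - 1) = e(l := e l - 1) \<longleftrightarrow> e' = e" if "e' l \<noteq> 0"
    proof
      assume *: "e'(l := e' l - 1) = e(l := e l - 1)"
      show "e' = e"
      proof
        fix m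
        show "e' m = e m" using fun_cong[OF *, of m] \<open>e l \<noteq> 0\<close> \<open>e' l \<noteq> 0\<close> by (cases "m = l") auto
      qed
    qed simp
    have "e' \<noteq> e" if "e' l = 0" using that \<open>e l \<noteq> 0\<close> by auto
    then show "weyl_op (wx l) (fun_of (bv (e(l := e l - 1)))) e' = fun_of (bv e) e'"
      unfolding weyl_op_gen fun_of_bv[OF e(1)]
      using eq fun_of_bv[OF lower[OF that, THEN conjunct1]] by (cases "e' l = 0") simp_all
  qed
  show ?thesis
  proof (cases "\<exists>l<n. e l \<noteq> 0")
    case True
    then obtain l where l: "l < n" "e l \<noteq> 0" by blast
    then obtain i where i: "\<iota> i = l" using \<iota>_surj by blast
    have "act (weyl_gen (GX i)) (bv (e(l := e l - 1))) = bv e"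
      using wx[OF l(2)] i by (intro fun_of_eqI) (simp add: fun_of_act eval_hom rep_def)
    then show ?thesis using lower[OF l(2)] by blast
  next
    case False
    obtain l where l: "e l \<noteq> 0" using e(2) by auto
    have "l < n + r" using e(1) l by (metis (mono_tags) exps_def mem_Collect_eq not_less)
    have "n \<le> l" using False l by (auto intro: leI)
    define m where "m = l - (n - 1)"
    have m: "0 < m" "m \<le> r" "m < n" "n - 1 + m = l"
      using r_less \<open>l < n + r\<close> \<open>n \<le> l\<close> by (auto simp: m_def)
    then obtain i where i: "\<iota> i = m" using \<iota>_surj by blast
    have "(e(l := e l - 1)) m = 0" using False m \<open>n \<le> l\<close> by auto
    then have "e'(m := Suc (e' m)) \<noteq> e(l := e l - 1)" for e' by (metis fun_upd_same nat.distinct(1))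
    then have "weyl_op (wd m) (fun_of (bv (e(l := e l - 1)))) e' = 0" for e'
      using fun_of_bv[OF lower[OF l, THEN conjunct1]] by (simp add: weyl_op_gen)
    then have "act (weyl_gen (GD i)) (bv (e(l := e l - 1))) = bv e"
      using wx[OF l] i m
      by (intro fun_of_eqI) (simp add: fun_eq_iff fun_of_act eval_hom rep_def D_def weyl_op_add)
    then show ?thesis using lower[OF l] by blast
  qed
qed

text \<open>The sequence \<open>S\<close> is arbitrary to serve two purposes: a constant one shows
  that 1 generates the module, and an increasing filtration gives the lower bound for
  growth.\<close>

lemma bv_reach:
  assumes S0: "bv (\<lambda>l. 0) \<in> S 0" and S: "\<And>m u g. u \<in> S m \<Longrightarrow> act (weyl_gen g) u \<in> S (Suc m)"
    and e: "e \<in> exps"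
  shows "bv e \<in> S (deg e)"
  using e
proof (induction "deg e" arbitrary: e)
  case 0
  have "e l = 0" for l
    using 0 by (cases "l < n + r") (auto simp: deg_def exps_def)
  then have "e = (\<lambda>l. 0)" by (rule ext)
  then show ?case using S0 by (simp add: deg_def)
next
  case (Suc m)
  then have "e \<noteq> (\<lambda>l. 0)" by (auto simp: deg_def)
  from bv_step[OF Suc.prems this] obtain g e' where
    "e' \<in> exps" "Suc (deg e') = deg e" "act (weyl_gen g) (bv e') = bv e" by blast
  with Suc S[of "bv e'" "deg e'" g] show ?case by simp
qed

lemma submodule_eq_UNIV:
  assumes N: "M.submodule N" and bv0: "bv (\<lambda>l. 0) \<in> N"
  shows "N = UNIV"
proof -
  have bv: "bv e \<in> N" if "e \<in> exps" for e
    using bv_reach[of "\<lambda>_. N", OF bv0 _ that] N by (simp add: M.submodule_def)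
  have "u \<in> N" for u
  proof (induction u rule: update_induct)
    case const
    show ?case using N by (simp add: M.submodule_def)
  next
    case (update u m c)
    obtain e where e: "e \<in> exps" "m = enc e" by (rule enc_surj)
    have "act (weyl_scalar c) (bv e) = Poly_Mapping.single m c"
      using e by (intro fun_of_eqI) (simp add: fun_eq_iff fun_of_act_scalar fun_of_bv fun_of_single)
    then have "Poly_Mapping.single m c \<in> N"
      using bv[OF e(1)] N unfolding M.submodule_def by metis
    then show ?case
      using update N by (simp add: update_eq_add_single M.submodule_def)
  qed
  then show ?thesis by blast
qed

text \<open>\<open>\<Delta>\<close> is a polynomial expression in images of generators, so every
  submodule is stable under it.\<close>

lemma \<Delta>_preimage: "\<exists>a. weyl.weyl_eval (rep \<iota>) a = (\<Delta> :: (nat, 'k) weyl)"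
proof -
  define R where "R = range (weyl.weyl_eval (rep \<iota>) :: ('n, 'k) weyl \<Rightarrow> (nat, 'k) weyl)"
  have R_add: "a + b \<in> R" if "a \<in> R" "b \<in> R" for a b
    using that unfolding R_def by (auto simp: image_iff) (metis eval_hom(1))
  have R_mult: "a * b \<in> R" if "a \<in> R" "b \<in> R" for a b
    using that unfolding R_def by (auto simp: image_iff) (metis eval_hom(2))
  have R_scalar: "weyl_scalar c \<in> R" for c
    unfolding R_def by (metis eval_hom(3) rangeI)
  have R_one: "1 \<in> R" using R_scalar[of 1] by (simp add: weyl.emb_one)
  have R_diff: "a - b \<in> R" if "a \<in> R" "b \<in> R" for a b
    using R_add[OF that(1) R_mult[OF R_scalar[of "- 1"] that(2)]] by (simp add: weyl.emb_uminus weyl.emb_one)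
  have R_power: "a ^ k \<in> R" if "a \<in> R" for a k
    using that by (induction k) (simp_all add: R_one R_mult)
  have R_sum: "sum a I \<in> R" if "\<And>i. i \<in> I \<Longrightarrow> a i \<in> R" for a and I :: "nat set"
    using that R_scalar[of 0]
    by (induction I rule: infinite_finite_induct) (simp_all add: weyl.emb_zero R_add)
  have R_gen: "wx l \<in> R \<and> D l \<in> R" if "l < n" for l
  proof -
    obtain i where "\<iota> i = l" using \<iota>_surj[OF \<open>l < n\<close>] .
    then show ?thesis
      using eval_hom(4)[of "GX i"] eval_hom(4)[of "GD i"] unfolding R_def rep_def
      by (auto simp: image_iff) (metis, metis)
  qed
  have D0: "D0 = D 0" by (simp add: D_def)
  have "\<Delta> \<in> R"
    using r_less unfolding \<Delta>_def D0
    by (intro R_add R_diff R_sum R_mult R_power R_one R_gen[THEN conjunct1] R_gen[THEN conjunct2]) auto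
  then show ?thesis unfolding R_def by (metis imageE)
qed

lemma irreducible: "M.irreducible_module"
proof -
  have "bv (\<lambda>l. 0) \<noteq> 0" by (metis bv_def lookup_single_eq lookup_zero zero_neq_one)
  moreover have "N = {0} \<or> N = UNIV" if N: "M.submodule N" for N
  proof (cases "N = {0}")
    case False
    then obtain u where u: "u \<in> N" "u \<noteq> 0" using N unfolding M.submodule_def by blast
    then obtain e where e: "fun_of u e \<noteq> 0"
      using fun_of_eqI[of u 0] by (auto simp: fun_of_zero fun_eq_iff)
    define L where "L = fun_of ` N"
    have stable: "weyl_op (weyl.weyl_eval (rep \<iota>) a) f \<in> L" if "f \<in> L" for a f
      using that N unfolding L_def by (auto simp: M.submodule_def simp flip: fun_of_act)
    obtain i where i: "\<iota> i = 0" using \<iota>_surj[of 0] r_less by auto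
    obtain a where a: "weyl.weyl_eval (rep \<iota>) a = (\<Delta> :: (nat, 'k) weyl)" using \<Delta>_preimage by blast
    have "\<exists>g\<in>L. g (\<lambda>l. 0) \<noteq> 0 \<and> (\<forall>e. e \<noteq> (\<lambda>l. 0) \<longrightarrow> g e = 0)"
    proof (rule exists_constant)
      show "L \<subseteq> polys" using fun_of_polys by (auto simp: L_def polys_def)
      show "(\<lambda>e. f e + h e) \<in> L" if fh: "f \<in> L" "h \<in> L" for f h
      proof -
        obtain u v where "u \<in> N" "v \<in> N" "f = fun_of u" "h = fun_of v" using fh by (auto simp: L_def)
        then show ?thesis
          using N unfolding L_def M.submodule_def
          by (intro image_eqI[of _ _ "u + v"]) (auto simp: fun_of_add)
      qed
      show "weyl_op (weyl_scalar c) f \<in> L" if "f \<in> L" for c f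
        using stable[OF that, of "weyl_scalar c"] by (simp add: eval_hom)
      show "weyl_op (wx 0) f \<in> L" if "f \<in> L" for f
        using stable[OF that, of "weyl_gen (GX i)"] i by (simp add: eval_hom rep_def)
      show "weyl_op \<Delta> f \<in> L" if "f \<in> L" for f
        using stable[OF that, of a] a by simp
      show "fun_of u \<in> L" using u by (simp add: L_def)
    qed (use e in blast)
    then obtain w where w: "w \<in> N" "fun_of w (\<lambda>l. 0) \<noteq> 0" "\<And>e. e \<noteq> (\<lambda>l. 0) \<Longrightarrow> fun_of w e = 0"
      by (auto simp: L_def)
    have "act (weyl_scalar (1 / fun_of w (\<lambda>l. 0))) w = bv (\<lambda>l. 0)"
    proof (rule fun_of_eqI, rule ext)
      fix e
      show "fun_of (act (weyl_scalar (1 / fun_of w (\<lambda>l. 0))) w) e = fun_of (bv (\<lambda>l. 0)) e"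
        using w(2) w(3)[of e] unfolding fun_of_act_scalar fun_of_bv[OF zero_exps] by auto
    qed
    then have "bv (\<lambda>l. 0) \<in> N" using w(1) N unfolding M.submodule_def by metis
    then show ?thesis using submodule_eq_UNIV[OF N] by blast
  qed simp
  ultimately show ?thesis unfolding M.irreducible_module_def by blast
qed

end

section \<open>Gelfand-Kirillov dimension of the module\<close>

context weyl_module
begin

definition boxm :: "nat \<Rightarrow> (nat \<Rightarrow>\<^sub>0 'k) set" where
  "boxm t = {u. fun_of u \<in> box_space t}"

lemma subspace_boxm: "M.mdl.subspace (boxm t)"
  unfolding M.mdl.subspace_def boxm_def
proof (intro conjI ballI allI)
  show "0 \<in> {u. fun_of u \<in> box_space t}" by (simp add: box_space_def fun_of_zero)
  show "u + v \<in> {u. fun_of u \<in> box_space t}"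
    if "u \<in> {u. fun_of u \<in> box_space t}" "v \<in> {u. fun_of u \<in> box_space t}" for u v
    using box_space_linear[of "fun_of u" t "fun_of v" 1 1] that by (simp add: fun_of_add[abs_def])
  show "act (weyl_scalar c) u \<in> {u. fun_of u \<in> box_space t}"
    if "u \<in> {u. fun_of u \<in> box_space t}" for c u
    using that by (simp add: box_space_def fun_of_act_scalar)
qed

lemma fun_of_sum: "fun_of (sum u I) e = (\<Sum>i\<in>I. fun_of (u i) e)"
  by (induction I rule: infinite_finite_induct) (simp_all add: fun_of_zero fun_of_add)

lemma box_exps: "e \<in> box t \<Longrightarrow> e \<in> exps"
  by (simp add: box_def exps_def)

lemma fun_of_lincomb:
  assumes "e' \<in> exps"
  shows "fun_of (\<Sum>e\<in>box t. act (weyl_scalar (c e)) (bv e)) e' = (if e' \<in> box t then c e' else 0)"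
proof -
  have "fun_of (\<Sum>e\<in>box t. act (weyl_scalar (c e)) (bv e)) e' = (\<Sum>e\<in>box t. if e' = e then c e else 0)"
    unfolding fun_of_sum by (rule sum.cong) (simp_all add: fun_of_act_scalar fun_of_bv box_exps)
  then show ?thesis by (simp add: finite_box)
qed

lemma boxm_span: "boxm t \<subseteq> M.mdl.span (bv ` box t)"
proof
  fix u assume u: "u \<in> boxm t"
  have "u = (\<Sum>e\<in>box t. act (weyl_scalar (fun_of u e)) (bv e))" (is "u = ?s")
  proof (rule fun_of_eqI, rule ext)
    fix e
    show "fun_of u e = fun_of ?s e"
    proof (cases "e \<in> exps")
      case True
      then show ?thesis using u fun_of_lincomb[OF True] by (auto simp: boxm_def box_space_def)
    next
      case False
      then show ?thesis by (simp add: fun_of_def)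
    qed
  qed
  also have "\<dots> \<in> M.mdl.span (bv ` box t)"
    by (intro M.mdl.span_sum M.mdl.span_scale M.mdl.span_base imageI)
  finally show "u \<in> M.mdl.span (bv ` box t)" .
qed

lemma inj_on_bv: "inj_on bv exps"
  by (rule inj_onI) (metis fun_of_bv zero_neq_one)

lemma card_bv_box: "card (bv ` box t) = (t + 1) ^ (n + r)"
  using inj_on_bv box_exps by (subst card_image) (auto simp: card_box intro: inj_on_subset)

lemma independent_bv_box: "M.mdl.independent (bv ` box t)"
proof (rule M.mdl.independent_if_scalars_zero)
  show "finite (bv ` box t)" by (simp add: finite_box)
  fix f x assume 0: "(\<Sum>x\<in>bv ` box t. act (weyl_scalar (f x)) x) = 0" and x: "x \<in> bv ` box t"
  then obtain e where e: "e \<in> box t" "x = bv e" by blast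
  have "inj_on bv (box t)" using inj_on_bv box_exps by (auto intro: inj_on_subset)
  then have "(\<Sum>e\<in>box t. act (weyl_scalar (f (bv e))) (bv e)) = 0"
    using 0 by (simp add: sum.reindex)
  then show "f x = 0"
    using fun_of_lincomb[OF box_exps[OF e(1)], of "\<lambda>e. f (bv e)" t] e by (simp add: fun_of_zero)
qed

text \<open>The filtration stays inside cubes whose side is linear in m. Conversely, a monomial of
  degree k is reached from 1 by k generators, each lying in the p-th power of \<open>V\<close>, so a
  cube of side about (m - q) / (p (n + r)) is filled.\<close>

lemma growth:
  assumes V: "M.alg_gen_subspace V" and F: "M.mod_gen_subspace F"
  shows "M.growth_exponent V F = ereal (real (n + r))"
proof -
  define W where "W m = M.subspace_act (M.subspace_power V m) F" for m
  have one: "1 \<in> V" using V by (simp add: M.alg_gen_subspace_def)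
  have W_mono: "W m \<subseteq> W k" if "m \<le> k" for m k
    unfolding W_def by (intro M.subspace_act_mono M.subspace_power_mono one that)
  have "\<exists>a b. \<forall>m. W m \<subseteq> boxm (a * m + b)"
    unfolding W_def
  proof (rule M.filtration_bound[OF V F subspace_boxm])
    show "boxm s \<subseteq> boxm t" if "s \<le> t" for s t
      using box_space_mono[OF that] by (auto simp: boxm_def)
    show "\<exists>t. u \<in> boxm t" for u using fun_of_polys by (simp add: boxm_def)
    show "\<exists>c. \<forall>t. \<forall>u\<in>boxm t. act a u \<in> boxm (t + c)" for a
      using bounded_op_eval[of a] unfolding bounded_op_def by (auto simp: boxm_def fun_of_act)
  qed
  then obtain a b where ab: "\<And>m. W m \<subseteq> boxm (a * m + b)" by blast
  have W_span: "W m \<subseteq> M.mdl.span (bv ` box (a * m + b))" for m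
    using ab boxm_span by blast
  have upper: "M.mdl.dim (W m) \<le> (a * m + (b + 1)) ^ (n + r)" for m
    using M.mdl.dim_le_card[OF W_span[of m]] by (simp add: finite_box card_bv_box)
  have fin: "finite (UNIV :: 'n weyl_gen set)"
  proof -
    have "finite (UNIV :: 'n set)" using \<iota> bij_betw_finite by blast
    moreover have "(UNIV :: 'n weyl_gen set) = range GX \<union> range GD"
      by (auto simp: image_iff) (metis weyl_gen.exhaust)
    ultimately show ?thesis by (metis finite_UnI finite_imageI)
  qed
  have "\<forall>g. \<exists>m. weyl_gen g \<in> M.subspace_power V m"
    by (intro allI M.ex_mem_subspace_power[OF V])
  from choice[OF this] obtain k where k: "\<And>g. weyl_gen g \<in> M.subspace_power V (k g)" by auto
  \<comment> \<open>The successor makes p, and with it the divisor \<open>c\<close>,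
    positive.\<close>
  define p where "p = Suc (Max (range k))"
  have gens: "weyl_gen g \<in> M.subspace_power V p" for g
  proof -
    have "k g \<le> p" using fin by (simp add: p_def le_SucI)
    from M.subspace_power_mono[OF one this] show ?thesis using k by blast
  qed
  obtain q where q: "bv (\<lambda>l. 0) \<in> W q" using M.ex_mem_subspace_act[OF V F] unfolding W_def by metis
  have reach: "bv e \<in> W (p * deg e + q)" if "e \<in> exps" for e
  proof (rule bv_reach[of "\<lambda>m. W (p * m + q)", OF _ _ that])
    show "bv (\<lambda>l. 0) \<in> W (p * 0 + q)" using q by simp
    show "act (weyl_gen g) u \<in> W (p * Suc m + q)" if "u \<in> W (p * m + q)" for m u g
      using M.act_mem_subspace_act[OF gens that[unfolded W_def]] by (simp add: W_def add.assoc)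
  qed
  define c where "c = p * (n + r)"
  have "c > 0" using r_less by (simp add: c_def p_def)
  define s where "s m = (m - q) div c" for m
  have lower: "(s m + 1) ^ (n + r) \<le> M.mdl.dim (W m)" if "m \<ge> q" for m
  proof -
    have "bv e \<in> W m" if e: "e \<in> box (s m)" for e
    proof -
      have "deg e \<le> (\<Sum>l<n + r. s m)" unfolding deg_def using e by (intro sum_mono) (auto simp: box_def)
      then have "p * deg e \<le> c * s m" by (simp add: c_def mult.assoc)
      also have "\<dots> \<le> m - q" by (simp add: s_def)
      finally have "p * deg e + q \<le> m" using \<open>m \<ge> q\<close> by simp
      then show ?thesis using reach[OF box_exps[OF e]] W_mono by blast
    qed
    then have "card (bv ` box (s m)) \<le> M.mdl.dim (W m)"
      using M.mdl.card_le_dim_of_finite_span[OF independent_bv_box _ W_span[of m], of "s m"]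
      by (auto simp: finite_box)
    then show ?thesis by (simp add: card_bv_box)
  qed
  show ?thesis
    unfolding M.growth_exponent_def W_def[symmetric]
  proof (rule limsup_log_polynomial_growth[OF upper])
    show "m - q < c * (s m + 1)" for m
      using dividend_less_times_div[OF \<open>c > 0\<close>, of "m - q"] by (simp add: s_def)
  qed (use lower in blast)
qed

text \<open>By \<open>growth\<close> all admissible pairs give the same value, so the choice in
  \<open>gk_dim\<close> is determined once one pair exists: the span of 1 and the generators, and
  the line of constants.\<close>

lemma gk_dim_eq: "M.gk_dim = ereal (real (n + r))"
proof -
  have "finite (UNIV :: 'n set)" using \<iota> bij_betw_finite by blast
  then have fin: "finite (insert 1 (range wx \<union> range wd :: ('n, 'k) weyl set))"
    by simp
  let ?B = "insert 1 (range wx \<union> range wd :: ('n, 'k) weyl set)"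
  have V: "M.alg_gen_subspace (M.alg.span ?B)"
    unfolding M.alg_gen_subspace_def
  proof (intro conjI allI impI)
    show "\<exists>B. finite B \<and> M.alg.span B = M.alg.span ?B" using fin by blast
    show "1 \<in> M.alg.span ?B" by (simp add: M.alg.span_base)
    fix S assume S: "M.subalgebra S \<and> M.alg.span ?B \<subseteq> S"
    have "a \<in> S" for a
    proof (induction a rule: weyl_induct)
      case (scalar c)
      have "weyl_scalar c * 1 \<in> S"
        using S M.alg.subspace_scale[of S 1 c] by (simp add: M.subalgebra_def)
      then show ?case by simp
    next
      case (gen g)
      have "weyl_gen g \<in> ?B" by (cases g) auto
      then have "weyl_gen g \<in> M.alg.span ?B" by (rule M.alg.span_base)
      then show ?case using S by auto
    next
      case (add a b)
      then show ?case using S M.alg.subspace_add[of S a b] by (simp add: M.subalgebra_def)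
    next
      case (mult a b)
      then show ?case using S by (simp add: M.subalgebra_def)
    qed
    then show "S = UNIV" by blast
  qed (rule M.alg.subspace_span)
  have F: "M.mod_gen_subspace (M.mdl.span {bv (\<lambda>l. 0)})"
    unfolding M.mod_gen_subspace_def
  proof (intro conjI allI impI)
    show "\<exists>B. finite B \<and> M.mdl.span B = M.mdl.span {bv (\<lambda>l. 0)}" by blast
    fix N assume N: "M.submodule N \<and> M.mdl.span {bv (\<lambda>l. 0)} \<subseteq> N"
    have "bv (\<lambda>l. 0) \<in> M.mdl.span {bv (\<lambda>l. 0)}" by (simp add: M.mdl.span_base)
    then show "N = UNIV" using N by (intro submodule_eq_UNIV) auto
  qed (rule M.mdl.subspace_span)
  show ?thesis
    unfolding M.gk_dim_def
  proof (rule some_equality)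
    show "\<exists>V F. M.alg_gen_subspace V \<and> M.mod_gen_subspace F \<and>
        ereal (real (n + r)) = M.growth_exponent V F"
      using V F growth[OF V F] by metis
  qed (use growth in blast)
qed

end

context shamsuddin
begin

text \<open>The exponents form a countable union of finite cubes, and the powers of x make it
  infinite.\<close>

lemma ex_enumeration:
  "\<exists>enc :: (nat \<Rightarrow> nat) \<Rightarrow> nat. bij_betw enc {e. \<forall>l\<ge>n + r. e l = 0} UNIV"
proof -
  let ?E = "{e :: nat \<Rightarrow> nat. \<forall>l\<ge>n + r. e l = 0}"
  have "e \<in> box (sum e {..<n + r})" if "e \<in> ?E" for e
    using that by (auto simp: box_def intro!: member_le_sum)
  then have "?E \<subseteq> (\<Union>t. box t)" by blast
  moreover have "countable (\<Union>t. box t)" by (simp add: countable_finite finite_box)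
  ultimately have "countable ?E" by (rule countable_subset)
  moreover have "infinite ?E"
  proof
    assume "finite ?E"
    moreover have "range (\<lambda>k l. if l = 0 then k else 0) \<subseteq> ?E" using r_less by auto
    moreover have "inj (\<lambda>k l :: nat. if l = 0 then k else 0 :: nat)"
      by (rule injI) (metis (full_types))
    ultimately show False using finite_subset finite_imageD infinite_UNIV_nat by blast
  qed
  ultimately show ?thesis by (metis countableE_infinite)
qed

end

theorem theoremA3:
  fixes j :: nat
  assumes "CARD('n::finite) \<le> j" and "j \<le> 2 * CARD('n) - 1"
  shows "\<exists>M :: ('n, 'k::{alg_closed_field, field_char_0}) weyl
               \<Rightarrow> (nat \<Rightarrow>\<^sub>0 'k) \<Rightarrow> (nat \<Rightarrow>\<^sub>0 'k).
           algebra_left_module weyl_scalar M \<and>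
           left_module.irreducible_module M \<and>
           algebra_left_module.gk_dim weyl_scalar M = ereal (real j)"
proof -
  \<comment> \<open>The upper bound on \<open>j\<close> gives r <= n - 1, so that each added xi_i
    has a partner q_i different from x.\<close>
  define n r where "n = CARD('n)" and "r = j - n"
  have j: "n + r = j" "r < n"
    using assms zero_less_card_finite[where 'a='n] unfolding n_def r_def by linarith+
  interpret shamsuddin n r using j by unfold_locales
  obtain \<iota> :: "'n \<Rightarrow> nat" where \<iota>: "bij_betw \<iota> UNIV {..<n}"
    using ex_bij_betw_finite_nat[of "UNIV :: 'n set"] by (auto simp: n_def lessThan_atLeast0)
  obtain enc :: "(nat \<Rightarrow> nat) \<Rightarrow> nat" where enc: "bij_betw enc {e. \<forall>l\<ge>n + r. e l = 0} UNIV"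
    using ex_enumeration by blast
  interpret W: weyl_module n r "TYPE('k)" \<iota> enc
    using \<iota> enc by unfold_locales
  show ?thesis
    using W.algebra_left_module_act W.irreducible W.gk_dim_eq j(1) by metis
qed

end
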